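(* Let $(\varphi_\lambda)_{\lambda\in[0,1]}$ be a continuous family of flows on a manifold $M$. Let $K\subseteq M$ be a compact set that is invariant under $\varphi_\lambda$ for every $\lambda\in[0,1]$ and that is an isolated non-saddle set for $\varphi_0$. Let $(K_\lambda)$ be a continuation of $K$. Then there exists $\lambda_0>0$ such that for every $\lambda\in[0,\lambda_0)$, $K_\lambda$ is an isolated non-saddle set for $\varphi_\lambda$ and $\check{H}^*(K_\lambda)\cong\check{H}^*(K)$.
   Context: A continuous family of flows is a continuous map $(x,t,\lambda)\mapsto\varphi_\lambda(x,t)$ such that each $\varphi_\lambda:M\times\mathbb{R}\to M$ is a flow. A compact invariant set $K$ is isolated for a flow if it is the maximal invariant subset of some compact neighbourhood $N$ of itself (an isolating neighbourhood). A compact invariant set $K$ is non-saddle for a flow $\varphi$ if every neighbourhood $U$ of $K$ contains a neighbourhood $V$ of $K$ such that every $x\in V$ satisfies $\varphi(x,[0,+\infty))\subseteq U$ or $\varphi(x,(-\infty,0])\subseteq U$. Continuation: if $N$ is an isolating neighbourhood of $K$ for $\varphi_0$, then $N$ is an isolating neighbourhood for $\varphi_\lambda$ for all $\lambda$ in some interval $[0,\delta)$, and $K_\lambda$ is defined as the maximal $\varphi_\lambda$-invariant subset of $N$; for $\lambda$ small this does not depend on the choice of $N$. $\check{H}^*$ denotes Čech cohomology. *)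

theory Defs
  imports "HOL-Analysis.Analysis" "HOL-Algebra.Group"
begin

definition is_flow :: "('a::topological_space \<Rightarrow> real \<Rightarrow> 'a) \<Rightarrow> bool" where
  "is_flow f \<longleftrightarrow> continuous_on UNIV (\<lambda>(x, t). f x t) \<and> (\<forall>x. f x 0 = x)
     \<and> (\<forall>x s t. f (f x t) s = f x (t + s))"

definition continuous_family_of_flows :: "(real \<Rightarrow> 'a::topological_space \<Rightarrow> real \<Rightarrow> 'a) \<Rightarrow> bool" where
  "continuous_family_of_flows \<phi> \<longleftrightarrow>
     continuous_on (UNIV \<times> UNIV \<times> {0..1}) (\<lambda>(x, t, l). \<phi> l x t)
     \<and> (\<forall>l\<in>{0..1}. is_flow (\<phi> l))"

definition invariant_set :: "('a \<Rightarrow> real \<Rightarrow> 'a) \<Rightarrow> 'a set \<Rightarrow> bool" where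
  "invariant_set f K \<longleftrightarrow> (\<forall>x\<in>K. \<forall>t. f x t \<in> K)"

definition Inv :: "('a \<Rightarrow> real \<Rightarrow> 'a) \<Rightarrow> 'a set \<Rightarrow> 'a set" where
  "Inv f N = {x. \<forall>t. f x t \<in> N}"

definition isolating_nbhd :: "('a::topological_space \<Rightarrow> real \<Rightarrow> 'a) \<Rightarrow> 'a set \<Rightarrow> 'a set \<Rightarrow> bool" where
  "isolating_nbhd f N K \<longleftrightarrow> compact N \<and> K \<subseteq> interior N \<and> Inv f N = K"

definition isolated_set :: "('a::topological_space \<Rightarrow> real \<Rightarrow> 'a) \<Rightarrow> 'a set \<Rightarrow> bool" where
  "isolated_set f K \<longleftrightarrow> compact K \<and> invariant_set f K \<and> (\<exists>N. isolating_nbhd f N K)"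

definition non_saddle :: "('a::topological_space \<Rightarrow> real \<Rightarrow> 'a) \<Rightarrow> 'a set \<Rightarrow> bool" where
  "non_saddle f K \<longleftrightarrow> compact K \<and> invariant_set f K \<and>
     (\<forall>U. K \<subseteq> interior U \<longrightarrow>
        (\<exists>V. K \<subseteq> interior V \<and> V \<subseteq> U \<and>
             (\<forall>x\<in>V. (\<forall>t\<ge>0. f x t \<in> U) \<or> (\<forall>t\<le>0. f x t \<in> U))))"

definition locally_euclidean :: "'a::topological_space itself \<Rightarrow> 'b::euclidean_space itself \<Rightarrow> bool" where
  "locally_euclidean _ _ \<longleftrightarrow>
     (\<forall>x::'a. \<exists>U. open U \<and> x \<in> U \<and> (\<exists>V::'b set. open V \<and> U homeomorphic V))"

definition open_covers :: "'a::topological_space set \<Rightarrow> 'a set set set" where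
  "open_covers X = {U. (\<forall>A\<in>U. openin (top_of_set X) A) \<and> \<Union>U = X}"

definition nerve_simplex :: "'a set set \<Rightarrow> nat \<Rightarrow> 'a set list \<Rightarrow> bool" where
  "nerve_simplex U q s \<longleftrightarrow> length s = Suc q \<and> set s \<subseteq> U \<and> \<Inter>(set s) \<noteq> {}"

definition cochains :: "'a set set \<Rightarrow> nat \<Rightarrow> ('a set list \<Rightarrow> int) set" where
  "cochains U q = {c. \<forall>s. \<not> nerve_simplex U q s \<longrightarrow> c s = 0}"

definition del_nth :: "nat \<Rightarrow> 'b list \<Rightarrow> 'b list" where
  "del_nth i s = take i s @ drop (Suc i) s"

definition coboundary :: "'a set set \<Rightarrow> nat \<Rightarrow> ('a set list \<Rightarrow> int) \<Rightarrow> 'a set list \<Rightarrow> int" where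
  "coboundary U q c s =
     (if nerve_simplex U (Suc q) s
      then (\<Sum>i\<le>Suc q. (-1) ^ i * c (del_nth i s)) else 0)"

definition cocycles :: "'a set set \<Rightarrow> nat \<Rightarrow> ('a set list \<Rightarrow> int) set" where
  "cocycles U q = {c \<in> cochains U q. coboundary U q c = (\<lambda>_. 0)}"

definition coboundaries :: "'a set set \<Rightarrow> nat \<Rightarrow> ('a set list \<Rightarrow> int) set" where
  "coboundaries U q = (case q of 0 \<Rightarrow> {\<lambda>_. 0} | Suc p \<Rightarrow> coboundary U p ` cochains U p)"

definition refinement_map :: "'a set set \<Rightarrow> 'a set set \<Rightarrow> ('a set \<Rightarrow> 'a set) \<Rightarrow> bool" where
  "refinement_map W U \<tau> \<longleftrightarrow> (\<forall>B\<in>W. \<tau> B \<in> U \<and> B \<subseteq> \<tau> B)"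

definition pullback :: "'a set set \<Rightarrow> nat \<Rightarrow> ('a set \<Rightarrow> 'a set) \<Rightarrow> ('a set list \<Rightarrow> int) \<Rightarrow> 'a set list \<Rightarrow> int" where
  "pullback W q \<tau> c s = (if nerve_simplex W q s then c (map \<tau> s) else 0)"

definition cech_reps :: "'a::topological_space set \<Rightarrow> nat \<Rightarrow> ('a set set \<times> ('a set list \<Rightarrow> int)) set" where
  "cech_reps X q = {(U, c). U \<in> open_covers X \<and> c \<in> cocycles U q}"

text \<open>Two representatives are equivalent iff they become cohomologous on a
  common refinement (this is the direct limit over refinement).\<close>
definition cech_rel :: "'a::topological_space set \<Rightarrow> nat \<Rightarrow>
    (('a set set \<times> ('a set list \<Rightarrow> int)) \<times> ('a set set \<times> ('a set list \<Rightarrow> int))) set" where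
  "cech_rel X q = {((U, c), (V, d)). (U, c) \<in> cech_reps X q \<and> (V, d) \<in> cech_reps X q \<and>
     (\<exists>W \<tau> \<sigma>. W \<in> open_covers X \<and> refinement_map W U \<tau> \<and> refinement_map W V \<sigma> \<and>
        (\<lambda>s. pullback W q \<tau> c s - pullback W q \<sigma> d s) \<in> coboundaries W q)}"

definition cech_class :: "'a::topological_space set \<Rightarrow> nat \<Rightarrow> 'a set set \<Rightarrow> ('a set list \<Rightarrow> int)
    \<Rightarrow> ('a set set \<times> ('a set list \<Rightarrow> int)) set" where
  "cech_class X q U c = cech_rel X q `` {(U, c)}"

text \<open>The q-th Cech cohomology group of X with integer coefficients, as the
  direct limit over open covers (group law: add pullbacks to a common refinement).\<close>
definition cech_cohomology :: "'a::topological_space set \<Rightarrow> nat \<Rightarrow>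
    ('a set set \<times> ('a set list \<Rightarrow> int)) set monoid" where
  "cech_cohomology X q =
     \<lparr> carrier = cech_reps X q // cech_rel X q,
       mult = (\<lambda>a b. SOME r. \<exists>U c V d W \<tau> \<sigma>. (U, c) \<in> a \<and> (V, d) \<in> b \<and>
                W \<in> open_covers X \<and> refinement_map W U \<tau> \<and> refinement_map W V \<sigma> \<and>
                r = cech_class X q W (\<lambda>s. pullback W q \<tau> c s + pullback W q \<sigma> d s)),
       one = cech_class X q {X} (\<lambda>_. 0) \<rparr>"

end

theory Submission
  imports Defs
begin

text \<open>For a non-saddle set \<open>K\<close> the points of an isolating neighbourhood whose forward or backward
  orbit stays inside form a compact neighbourhood \<open>P\<close> of \<open>K\<close>, and \<open>K\<close> separates the forward part
  from the backward part. Since \<open>K\<close> is invariant under every \<open>\<phi>\<^sub>\<lambda>\<close>, perturbed orbits starting near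
  \<open>K\<close> cannot change sides, so near \<open>K\<close> every point still stays in \<open>P\<close> forwards or backwards under
  \<open>\<phi>\<^sub>\<lambda>\<close>; by compactness the continuation \<open>K\<^sub>\<lambda>\<close> is again non-saddle. Flowing the forward part
  forwards and the backward part backwards deforms such a \<open>P\<close> into any neighbourhood of its
  maximal invariant set while fixing that set. By homotopy invariance and continuity of Cech
  cohomology, the deformations for \<open>\<phi>\<^sub>0\<close> and \<open>\<phi>\<^sub>\<lambda>\<close> together make the restriction from \<open>K\<^sub>\<lambda>\<close> to
  \<open>K\<close> bijective.\<close>

section \<open>Cochains and contiguous simplicial maps\<close>

text \<open>The inclusion of \<open>K\<close> in its continuation \<open>L\<close> exists because
  \<open>K\<close> is invariant for the perturbed flow. Inverting its effect on cohomology rests on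
  a nesting K, L, R, C, Q, P of increasing sets. \<open>C\<close> is fixed before the parameter,
  whereas \<open>Q\<close>, the trapped part of \<open>P\<close> for the perturbed flow, varies with
  it; \<open>C\<close> lies in \<open>Q\<close> for all small parameters. \<open>R\<close> is a
  trapping set of the unperturbed flow inside \<open>C\<close>, and upper semicontinuity puts
  \<open>L\<close> inside \<open>R\<close>. Extending a class from \<open>K\<close> over
  \<open>R\<close> gives surjectivity. For injectivity, classes on \<open>L\<close> have to be
  extended to \<open>Q\<close>, because the unperturbed flow deforms \<open>L\<close> within
  \<open>R\<close> but not within \<open>L\<close>. On the cochain side, induced homomorphisms are
  replaced by the relation that two classes agree after pulling back along two maps, witnessed on
  one cover; a homomorphism is formed only for the final restriction. A neighbourhood of
  \<open>K\<close> need not retract to \<open>K\<close>, so extending a class uses a simplicial map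
  of nerves that no map of points carries.\<close>

definition alt_sum :: "('b list \<Rightarrow> int) \<Rightarrow> 'b list \<Rightarrow> int" where
  "alt_sum c s = (\<Sum>i<length s. (-1) ^ i * c (del_nth i s))"

text \<open>This is the prism operator, the alternating sum over i of
  \<open>c [t x0, ..., t xi, r xi, ..., r xp]\<close>, unfolded on the first vertex. Like
  \<open>alt_sum\<close> it ignores nerves and reads the degree off the length of the list, so its
  identities hold for arbitrary functions on lists.\<close>

fun prism :: "('b \<Rightarrow> 'c) \<Rightarrow> ('b \<Rightarrow> 'c) \<Rightarrow> ('c list \<Rightarrow> int) \<Rightarrow> 'b list \<Rightarrow> int" where
  "prism t r c [] = 0"
| "prism t r c (x # s) = c (t x # r x # map r s) - prism t r (\<lambda>s. c (t x # s)) s"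

lemma del_nth_Cons_0 [simp]: "del_nth 0 (x # s) = s"
  and del_nth_Cons_Suc [simp]: "del_nth (Suc i) (x # s) = x # del_nth i s"
  by (auto simp: del_nth_def)

lemma length_del_nth: "i < length s \<Longrightarrow> length (del_nth i s) = length s - 1"
  by (simp add: del_nth_def)

lemma set_del_nth: "set (del_nth i s) \<subseteq> set s"
  by (auto simp: del_nth_def dest: in_set_takeD in_set_dropD)

lemma map_del_nth: "map t (del_nth i s) = del_nth i (map t s)"
  by (simp add: del_nth_def take_map drop_map)

lemma alt_sum_Nil [simp]: "alt_sum c [] = 0"
  by (simp add: alt_sum_def)

lemma alt_sum_Cons: "alt_sum c (x # s) = c s - alt_sum (\<lambda>s. c (x # s)) s"
  by (simp add: alt_sum_def sum.lessThan_Suc_shift sum_negf del: sum.lessThan_Suc)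

lemma alt_sum_diff: "alt_sum (\<lambda>s. c s - d s) s = alt_sum c s - alt_sum d s"
  by (simp add: alt_sum_def algebra_simps sum_subtractf)

lemma alt_sum_add: "alt_sum (\<lambda>s. c s + d s) s = alt_sum c s + alt_sum d s"
  by (simp add: alt_sum_def algebra_simps sum.distrib)

lemma alt_sum_minus: "alt_sum (\<lambda>s. - c s) s = - alt_sum c s"
  by (simp add: alt_sum_def sum_negf)

lemma alt_sum_map: "alt_sum (\<lambda>s. c (map t s)) s = alt_sum c (map t s)"
  by (simp add: alt_sum_def map_del_nth)

lemma prism_diff: "prism t r (\<lambda>s. c s - d s) s = prism t r c s - prism t r d s"
  by (induction s arbitrary: c d) auto

text \<open>Chain homotopy formula. Peeling off \<open>x\<close> turns \<open>c\<close> into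
  \<open>\<lambda>s. c (t x # s)\<close>, so the induction has to run over all \<open>c\<close> at
  once.\<close>

lemma prism_identity:
  "prism t r (alt_sum c) s + alt_sum (prism t r c) s = c (map r s) - c (map t s)"
proof (induction s arbitrary: c)
  case (Cons x s)
  let ?c = "\<lambda>s. c (t x # s)"
  have "prism t r (\<lambda>s. alt_sum c (t x # s)) s = prism t r c s - prism t r (alt_sum ?c) s"
    by (simp add: alt_sum_Cons prism_diff)
  moreover have "alt_sum (\<lambda>s. prism t r c (x # s)) s
      = alt_sum (\<lambda>s. c (t x # r x # s)) (map r s) - alt_sum (prism t r ?c) s"
    by (simp add: alt_sum_diff alt_sum_map[symmetric])
  ultimately show ?case
    using Cons[of ?c] by (simp add: alt_sum_Cons)
qed simp

text \<open>Only the mixed tuples enter a prism. Contiguity makes exactly these simplices of the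
  target cover, so an equation valid merely on that nerve can be used under
  \<open>prism\<close>.\<close>

lemma prism_cong:
  assumes "\<And>i. i < length s \<Longrightarrow> c (map t (take (Suc i) s) @ map r (drop i s))
      = d (map t (take (Suc i) s) @ map r (drop i s))"
  shows "prism t r c s = prism t r d s"
  using assms
proof (induction s arbitrary: c d)
  case (Cons x s)
  have "c (t x # r x # map r s) = d (t x # r x # map r s)"
    using Cons.prems[of 0] by simp
  moreover have "prism t r (\<lambda>s. c (t x # s)) s = prism t r (\<lambda>s. d (t x # s)) s"
    by (rule Cons.IH) (use Cons.prems[of "Suc _"] in simp)
  ultimately show ?case by simp
qed simp

lemma prism_zero [simp]: "prism t r (\<lambda>_. 0) s = 0"
  by (induction s) auto

text \<open>With \<open>t = r\<close> this says that \<open>t\<close> is simplicial on nerves; no inclusion \<open>B \<subseteq> t B\<close> is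
  required, so that covers of different spaces can be compared.\<close>
definition contiguous :: "'b set set \<Rightarrow> 'a set set \<Rightarrow> ('b set \<Rightarrow> 'a set) \<Rightarrow> ('b set \<Rightarrow> 'a set) \<Rightarrow> bool" where
  "contiguous W U t r \<longleftrightarrow>
     (\<forall>S\<subseteq>W. \<Inter>S \<noteq> {} \<longrightarrow> t ` S \<union> r ` S \<subseteq> U \<and> \<Inter>(t ` S \<union> r ` S) \<noteq> {})"

lemma contiguous_simplex:
  assumes "contiguous W U t r" "nerve_simplex W q s" "length s' = Suc p"
    "set s' \<subseteq> t ` set s \<union> r ` set s"
  shows "nerve_simplex U p s'"
proof -
  have U: "t ` set s \<union> r ` set s \<subseteq> U" and ne: "\<Inter>(t ` set s \<union> r ` set s) \<noteq> {}"
    using assms(1,2) unfolding contiguous_def nerve_simplex_def by blast+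
  have "\<Inter>(set s') \<noteq> {}"
    using Inter_anti_mono[OF assms(4)] ne by (metis subset_empty)
  then show ?thesis
    using assms(3) subset_trans[OF assms(4) U] unfolding nerve_simplex_def by simp
qed

lemma nerve_simplex_del_nth:
  assumes "nerve_simplex W (Suc q) s" "i \<le> Suc q" shows "nerve_simplex W q (del_nth i s)"
  using assms set_del_nth[of i s] length_del_nth[of i s] Inter_anti_mono[OF set_del_nth[of i s]]
  unfolding nerve_simplex_def by auto

lemma coboundary_eq_alt_sum:
  "coboundary U q c s = (if nerve_simplex U (Suc q) s then alt_sum c s else 0)"
  by (auto simp: coboundary_def alt_sum_def nerve_simplex_def lessThan_Suc_atMost)

lemma alt_sum_cong_nerve:
  assumes "nerve_simplex W (Suc q) s" "\<And>s. nerve_simplex W q s \<Longrightarrow> c s = d s"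
  shows "alt_sum c s = alt_sum d s"
  unfolding alt_sum_def
proof (rule sum.cong)
  fix i assume "i \<in> {..<length s}"
  then have "i \<le> Suc q"
    using assms(1) by (simp add: nerve_simplex_def)
  then show "(- 1) ^ i * c (del_nth i s) = (- 1) ^ i * d (del_nth i s)"
    using assms(2) nerve_simplex_del_nth[OF assms(1)] by simp
qed simp

text \<open>Contiguous simplicial maps are chain homotopic through \<open>prism\<close>, and the
  term \<open>prism t r (alt_sum c)\<close> vanishes because \<open>c\<close> is a cocycle. This
  makes the class of a pullback independent of the chosen refinement map.\<close>

lemma contiguous_coboundaries:
  assumes "contiguous W U t r" "c \<in> cocycles U q"
  shows "(\<lambda>s. pullback W q t c s - pullback W q r c s) \<in> coboundaries W q"
proof -
  have *: "c (map r s) - c (map t s) = alt_sum (prism t r c) s" if s: "nerve_simplex W q s" for s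
  proof -
    have "prism t r (alt_sum c) s = prism t r (\<lambda>_. 0) s"
    proof (rule prism_cong)
      fix i assume i: "i < length s"
      let ?s = "map t (take (Suc i) s) @ map r (drop i s)"
      have "nerve_simplex U (Suc q) ?s"
        by (rule contiguous_simplex[OF assms(1) s])
           (use i s in \<open>auto simp: nerve_simplex_def dest: in_set_takeD in_set_dropD\<close>)
      moreover have "coboundary U q c ?s = 0"
        using assms(2) by (simp add: cocycles_def)
      ultimately show "alt_sum c ?s = 0"
        by (simp add: coboundary_eq_alt_sum)
    qed
    then show ?thesis
      using prism_identity[of t r c s] by simp
  qed
  show ?thesis
  proof (cases q)
    case 0
    \<comment> \<open>There are no cochains below degree 0: here the right side of \<open>*\<close>
      is a prism over the empty list, which is 0.\<close>
    have "c (map r s) = c (map t s)" if "nerve_simplex W 0 s" for s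
      using *[of s] that 0 by (auto simp: nerve_simplex_def length_Suc_conv alt_sum_Cons)
    then show ?thesis
      using 0 by (auto simp: coboundaries_def pullback_def)
  next
    case (Suc p)
    \<comment> \<open>The sign reverses \<open>*\<close>, which yields \<open>r\<close> minus
      \<open>t\<close>; cutting off outside the nerve turns the prism into a cochain.\<close>
    define e where "e s = (if nerve_simplex W p s then - prism t r c s else 0)" for s
    have "e \<in> cochains W p"
      by (auto simp: e_def cochains_def)
    moreover have "(\<lambda>s. pullback W q t c s - pullback W q r c s) = coboundary W p e"
    proof
      fix s
      show "pullback W q t c s - pullback W q r c s = coboundary W p e s"
      proof (cases "nerve_simplex W q s")
        case True
        have "alt_sum e s = alt_sum (\<lambda>s. - prism t r c s) s"
          by (rule alt_sum_cong_nerve[of W p]) (use True Suc in \<open>auto simp: e_def\<close>)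
        then show ?thesis
          using True Suc *[OF True] by (simp add: pullback_def coboundary_eq_alt_sum alt_sum_minus)
      qed (use Suc in \<open>auto simp: pullback_def coboundary_eq_alt_sum\<close>)
    qed
    ultimately show ?thesis
      using Suc by (auto simp: coboundaries_def)
  qed
qed

section \<open>Additive structure and functoriality of cocycles and coboundaries\<close>

lemma coboundaries_zero: "(\<lambda>_. 0) \<in> coboundaries U q"
proof (cases q)
  case (Suc p)
  have "coboundary U p (\<lambda>_. 0) = (\<lambda>_. 0)"
    by (auto simp: coboundary_def)
  then show ?thesis
    using Suc by (force simp: coboundaries_def cochains_def image_iff)
qed (simp add: coboundaries_def)

lemma coboundaries_diff:
  assumes "c \<in> coboundaries U q" "d \<in> coboundaries U q"
  shows "(\<lambda>s. c s - d s) \<in> coboundaries U q"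
proof (cases q)
  case (Suc p)
  then obtain c' d' where "c' \<in> cochains U p" "d' \<in> cochains U p"
    "c = coboundary U p c'" "d = coboundary U p d'"
    using assms by (auto simp: coboundaries_def)
  then have "(\<lambda>s. c s - d s) = coboundary U p (\<lambda>s. c' s - d' s)" "(\<lambda>s. c' s - d' s) \<in> cochains U p"
    by (auto simp: coboundary_eq_alt_sum alt_sum_diff cochains_def)
  then show ?thesis
    using Suc by (simp add: coboundaries_def)
qed (use assms in \<open>auto simp: coboundaries_def\<close>)

lemma coboundaries_minus: "c \<in> coboundaries U q \<Longrightarrow> (\<lambda>s. - c s) \<in> coboundaries U q"
  using coboundaries_diff[OF coboundaries_zero] by fastforce

lemma coboundaries_add:
  assumes "c \<in> coboundaries U q" "d \<in> coboundaries U q"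
  shows "(\<lambda>s. c s + d s) \<in> coboundaries U q"
  using coboundaries_diff[OF assms(1) coboundaries_minus[OF assms(2)]] by simp

lemma cocycles_add:
  assumes "c \<in> cocycles U q" "d \<in> cocycles U q"
  shows "(\<lambda>s. c s + d s) \<in> cocycles U q"
proof -
  have "coboundary U q (\<lambda>s. c s + d s) s = coboundary U q c s + coboundary U q d s" for s
    by (simp add: coboundary_eq_alt_sum alt_sum_add)
  then show ?thesis
    using assms by (simp add: cocycles_def cochains_def fun_eq_iff)
qed

lemma pullback_pullback:
  assumes "contiguous W V t t"
  shows "pullback W q t (pullback V q r c) = pullback W q (\<lambda>B. r (t B)) c"
proof -
  have "nerve_simplex V q (map t s)" if "nerve_simplex W q s" for s
    by (rule contiguous_simplex[OF assms that]) (use that in \<open>auto simp: nerve_simplex_def\<close>)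
  then show ?thesis
    by (simp add: pullback_def fun_eq_iff comp_def)
qed

lemma pullback_cochains: "pullback W q t c \<in> cochains W q"
  by (simp add: pullback_def cochains_def)

lemma coboundary_pullback:
  assumes "contiguous W V t t"
  shows "coboundary W q (pullback W q t c) = pullback W (Suc q) t (coboundary V q c)"
proof
  fix s
  show "coboundary W q (pullback W q t c) s = pullback W (Suc q) t (coboundary V q c) s"
  proof (cases "nerve_simplex W (Suc q) s")
    case True
    have "nerve_simplex V (Suc q) (map t s)"
      by (rule contiguous_simplex[OF assms True]) (use True in \<open>auto simp: nerve_simplex_def\<close>)
    moreover have "alt_sum (pullback W q t c) s = alt_sum (\<lambda>s. c (map t s)) s"
      by (rule alt_sum_cong_nerve[OF True]) (simp add: pullback_def)
    ultimately show ?thesis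
      using True by (simp add: coboundary_eq_alt_sum pullback_def alt_sum_map)
  qed (simp add: coboundary_eq_alt_sum pullback_def)
qed

lemma pullback_cocycles:
  assumes "contiguous W V t t" "c \<in> cocycles V q"
  shows "pullback W q t c \<in> cocycles W q"
  using assms(2) coboundary_pullback[OF assms(1), of q c]
  by (auto simp: cocycles_def pullback_cochains pullback_def fun_eq_iff)

lemma pullback_coboundaries:
  assumes "contiguous W V t t" "c \<in> coboundaries V q"
  shows "pullback W q t c \<in> coboundaries W q"
proof (cases q)
  case 0
  then show ?thesis
    using assms(2) by (auto simp: coboundaries_def pullback_def)
next
  case (Suc p)
  then obtain e where "c = coboundary V p e"
    using assms(2) by (auto simp: coboundaries_def)
  then have "pullback W q t c = coboundary W p (pullback W p t e)"
    using Suc coboundary_pullback[OF assms(1), of p e] by simp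
  then show ?thesis
    using Suc pullback_cochains[of W p t e] by (simp add: coboundaries_def)
qed

lemma pullback_diff:
  "pullback W q t (\<lambda>s. c s - d s) = (\<lambda>s. pullback W q t c s - pullback W q t d s)"
  and pullback_add:
  "pullback W q t (\<lambda>s. c s + d s) = (\<lambda>s. pullback W q t c s + pullback W q t d s)"
  by (auto simp: pullback_def)

section \<open>Comparing classes after pulling back\<close>

text \<open>A refinement map along \<open>g\<close>, without forming the preimage cover; for
  \<open>g\<close> the identity it is \<open>refinement_map\<close>. Two choices for one
  \<open>g\<close> are contiguous, so \<open>g\<close> has a single effect on cohomology, and two
  maps with a common carrier have the same effect.\<close>

definition carried :: "('a \<Rightarrow> 'b) \<Rightarrow> 'a set set \<Rightarrow> 'b set set \<Rightarrow> ('a set \<Rightarrow> 'b set) \<Rightarrow> bool" where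
  "carried g W U t \<longleftrightarrow> (\<forall>B\<in>W. t B \<in> U \<and> (\<forall>x\<in>B. g x \<in> t B))"

lemma refinement_map_iff_carried: "refinement_map W U t \<longleftrightarrow> carried (\<lambda>x. x) W U t"
  by (auto simp: refinement_map_def carried_def)

text \<open>If \<open>z\<close> lies in every member of \<open>S\<close>, then \<open>g z\<close>
  lies in every set that either carrier assigns to them.\<close>

lemma carried_contiguous:
  assumes "carried g W U t" "carried g W U r" shows "contiguous W U t r"
  unfolding contiguous_def
proof (intro allI impI)
  fix S assume S: "S \<subseteq> W" "\<Inter>S \<noteq> {}"
  then obtain z where z: "\<And>B. B \<in> S \<Longrightarrow> z \<in> B" by blast
  have *: "t B \<in> U \<and> g z \<in> t B \<and> r B \<in> U \<and> g z \<in> r B" if "B \<in> S" for B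
    using assms S(1) z that unfolding carried_def by (meson subsetD)
  then have "g z \<in> \<Inter>(t ` S \<union> r ` S)"
    by auto
  then show "t ` S \<union> r ` S \<subseteq> U \<and> \<Inter>(t ` S \<union> r ` S) \<noteq> {}"
    using * by (metis Un_least empty_iff image_subsetI)
qed

lemma carried_compose:
  "carried h Z W s \<Longrightarrow> carried g W U t \<Longrightarrow> carried (\<lambda>x. g (h x)) Z U (\<lambda>B. t (s B))"
  by (simp add: carried_def)

lemma open_coversD:
  assumes "W \<in> open_covers X" "B \<in> W" shows "openin (top_of_set X) B" "B \<subseteq> X"
  using assms unfolding open_covers_def by auto

lemma carried_cong:
  assumes "carried g W U t" "W \<in> open_covers X" "\<And>x. x \<in> X \<Longrightarrow> g x = g' x"
  shows "carried g' W U t"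
  using assms open_coversD(2)[OF assms(2)] unfolding carried_def by (metis subsetD)

text \<open>The cover consists of all relatively open sets admitting a witness, so the witness
  depends on the set alone and not on a point that produced it.\<close>

lemma local_open_cover:
  assumes "\<And>x. x \<in> X \<Longrightarrow> \<exists>B A. openin (top_of_set X) B \<and> x \<in> B \<and> P B A"
  obtains W t where "W \<in> open_covers X" "\<And>B. B \<in> W \<Longrightarrow> P B (t B)"
proof
  let ?W = "{B. openin (top_of_set X) B \<and> (\<exists>A. P B A)}"
  show "?W \<in> open_covers X"
    unfolding open_covers_def
  proof (intro CollectI conjI ballI equalityI subsetI)
    fix x assume "x \<in> \<Union>?W"
    then show "x \<in> X" using openin_imp_subset by fastforce
  next
    fix x assume "x \<in> X"
    then show "x \<in> \<Union>?W" using assms by blast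
  qed simp
  show "P B (SOME A. P B A)" if "B \<in> ?W" for B
    using that by (simp add: someI_ex)
qed

lemma open_cover_preimage:
  assumes "continuous_on X g" "g ` X \<subseteq> Y" "U \<in> open_covers Y" "x \<in> X"
  obtains A where "A \<in> U" "openin (top_of_set X) (X \<inter> g -` A)" "x \<in> X \<inter> g -` A"
proof -
  obtain A where A: "A \<in> U" "g x \<in> A"
    using assms(2-4) unfolding open_covers_def by blast
  have "openin (top_of_set X) (X \<inter> g -` A)"
    by (rule continuous_openin_preimage[OF assms(1) _ open_coversD(1)[OF assms(3) A(1)]]) (use assms(2) in auto)
  then show thesis using A assms(4) that by blast
qed

lemma common_refinement:
  assumes "continuous_on X g" "g ` X \<subseteq> Y" "U \<in> open_covers Y"
    and "continuous_on X h" "h ` X \<subseteq> Z" "V \<in> open_covers Z"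
  obtains W t r where "W \<in> open_covers X" "carried g W U t" "carried h W V r"
proof (rule local_open_cover)
  let ?P = "\<lambda>B A. fst A \<in> U \<and> (\<forall>x\<in>B. g x \<in> fst A) \<and> snd A \<in> V \<and> (\<forall>x\<in>B. h x \<in> snd A)"
  show "\<exists>B A. openin (top_of_set X) B \<and> x \<in> B \<and> ?P B A" if x: "x \<in> X" for x
  proof -
    obtain A where A: "A \<in> U" "openin (top_of_set X) (X \<inter> g -` A)" "x \<in> X \<inter> g -` A"
      using open_cover_preimage[OF assms(1-3) x] .
    obtain A' where A': "A' \<in> V" "openin (top_of_set X) (X \<inter> h -` A')" "x \<in> X \<inter> h -` A'"
      using open_cover_preimage[OF assms(4-6) x] .
    have "?P ((X \<inter> g -` A) \<inter> (X \<inter> h -` A')) (A, A')"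
      using A(1) A'(1) by simp
    then show ?thesis
      using openin_Int[OF A(2) A'(2)] A(3) A'(3) by blast
  qed
  fix W t assume "W \<in> open_covers X" "\<And>B. B \<in> W \<Longrightarrow> ?P B (t B)"
  then show thesis
    using that[of W "fst \<circ> t" "snd \<circ> t"] by (simp add: carried_def)
qed

lemma cover_pullback_exists:
  assumes "continuous_on X g" "g ` X \<subseteq> Y" "U \<in> open_covers Y"
  obtains W t where "W \<in> open_covers X" "carried g W U t"
  using common_refinement[OF assms assms] by metis

text \<open>The relation says that \<open>g\<^sup>* a = h\<^sup>* b\<close> in the \<open>q\<close>-th cohomology of \<open>X\<close>.\<close>
definition pb_eq :: "'a::topological_space set \<Rightarrow> nat \<Rightarrow> ('a \<Rightarrow> 'a) \<Rightarrow> ('a \<Rightarrow> 'a) \<Rightarrow>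
    'a set set \<times> ('a set list \<Rightarrow> int) \<Rightarrow> 'a set set \<times> ('a set list \<Rightarrow> int) \<Rightarrow> bool" where
  "pb_eq X q g h a b \<longleftrightarrow> (\<exists>W t r. W \<in> open_covers X \<and> carried g W (fst a) t \<and> carried h W (fst b) r \<and>
     (\<lambda>s. pullback W q t (snd a) s - pullback W q r (snd b) s) \<in> coboundaries W q)"

lemma pb_eqI:
  assumes "W \<in> open_covers X" "carried g W (fst a) t" "carried h W (fst b) r"
    "(\<lambda>s. pullback W q t (snd a) s - pullback W q r (snd b) s) \<in> coboundaries W q"
  shows "pb_eq X q g h a b"
  using assms unfolding pb_eq_def by blast

lemma cech_rel_iff:
  "(a, b) \<in> cech_rel X q \<longleftrightarrow> a \<in> cech_reps X q \<and> b \<in> cech_reps X q \<and> pb_eq X q (\<lambda>x. x) (\<lambda>x. x) a b"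
  by (cases a; cases b) (auto simp: cech_rel_def pb_eq_def refinement_map_iff_carried)

lemma cech_repsD:
  assumes "a \<in> cech_reps X q" shows "fst a \<in> open_covers X" "snd a \<in> cocycles (fst a) q"
  using assms by (auto simp: cech_reps_def)

lemma pb_eq_sym: "pb_eq X q g h a b \<Longrightarrow> pb_eq X q h g b a"
  unfolding pb_eq_def using coboundaries_minus by fastforce

lemma pb_eq_cong:
  assumes "pb_eq X q g h a b" "\<And>x. x \<in> X \<Longrightarrow> g x = g' x" "\<And>x. x \<in> X \<Longrightarrow> h x = h' x"
  shows "pb_eq X q g' h' a b"
proof -
  obtain W t r where W: "W \<in> open_covers X" "carried g W (fst a) t" "carried h W (fst b) r"
    "(\<lambda>s. pullback W q t (snd a) s - pullback W q r (snd b) s) \<in> coboundaries W q"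
    using assms(1) unfolding pb_eq_def by blast
  have "carried g' W (fst a) t" "carried h' W (fst b) r"
    using carried_cong[OF W(2,1) assms(2)] carried_cong[OF W(3,1) assms(3)] by simp_all
  then show ?thesis
    using W(1,4) by (intro pb_eqI)
qed

lemma pb_eq_of_carried:
  assumes "W \<in> open_covers X" "carried g W (fst a) t" "carried h W (fst a) t"
  shows "pb_eq X q g h a a"
  by (rule pb_eqI[OF assms]) (simp add: coboundaries_zero)

lemma pb_eq_refl:
  assumes "continuous_on X g" "g ` X \<subseteq> Y" "fst a \<in> open_covers Y"
  shows "pb_eq X q g g a a"
  using cover_pullback_exists[OF assms] pb_eq_of_carried by metis

lemma pb_eq_pullback:
  assumes "pb_eq X q g h a b" "continuous_on Z k" "k ` Z \<subseteq> X"
  shows "pb_eq Z q (\<lambda>x. g (k x)) (\<lambda>x. h (k x)) a b"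
proof -
  obtain W t r where W: "W \<in> open_covers X" "carried g W (fst a) t" "carried h W (fst b) r"
    and cob: "(\<lambda>s. pullback W q t (snd a) s - pullback W q r (snd b) s) \<in> coboundaries W q"
    using assms(1) unfolding pb_eq_def by blast
  obtain V p where V: "V \<in> open_covers Z" "carried k V W p"
    using cover_pullback_exists[OF assms(2,3) W(1)] .
  have p: "contiguous V W p p" using carried_contiguous V(2) by blast
  show ?thesis
  proof (rule pb_eqI)
    show "V \<in> open_covers Z" by fact
    show "carried (\<lambda>x. g (k x)) V (fst a) (\<lambda>B. t (p B))" "carried (\<lambda>x. h (k x)) V (fst b) (\<lambda>B. r (p B))"
      using carried_compose V(2) W(2,3) by blast+
    show "(\<lambda>s. pullback V q (\<lambda>B. t (p B)) (snd a) s - pullback V q (\<lambda>B. r (p B)) (snd b) s) \<in> coboundaries V q"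
      using pullback_coboundaries[OF p cob] by (simp add: pullback_diff pullback_pullback[OF p])
  qed
qed

lemma pb_eq_subset:
  assumes "pb_eq X q g h a b" "Z \<subseteq> X" shows "pb_eq Z q g h a b"
  using pb_eq_pullback[OF assms(1), of Z "\<lambda>x. x"] assms(2) by simp

text \<open>Both witnesses are pulled back to a common refinement, so that transitivity and addition
  can be computed in one cochain group.\<close>

lemma pb_eq_common:
  assumes "pb_eq X q g h a b" "pb_eq X q g' h' a' b'"
  obtains W t r t' r' where "W \<in> open_covers X"
    "carried g W (fst a) t" "carried h W (fst b) r" "carried g' W (fst a') t'" "carried h' W (fst b') r'"
    "(\<lambda>s. pullback W q t (snd a) s - pullback W q r (snd b) s) \<in> coboundaries W q"
    "(\<lambda>s. pullback W q t' (snd a') s - pullback W q r' (snd b') s) \<in> coboundaries W q"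
proof -
  obtain W t r where W: "W \<in> open_covers X" "carried g W (fst a) t" "carried h W (fst b) r"
    and cob: "(\<lambda>s. pullback W q t (snd a) s - pullback W q r (snd b) s) \<in> coboundaries W q"
    using assms(1) unfolding pb_eq_def by blast
  obtain W' t' r' where W': "W' \<in> open_covers X" "carried g' W' (fst a') t'" "carried h' W' (fst b') r'"
    and cob': "(\<lambda>s. pullback W' q t' (snd a') s - pullback W' q r' (snd b') s) \<in> coboundaries W' q"
    using assms(2) unfolding pb_eq_def by blast
  obtain V p p' where V: "V \<in> open_covers X" "carried (\<lambda>x. x) V W p" "carried (\<lambda>x. x) V W' p'"
    using common_refinement[of X "\<lambda>x. x" X W "\<lambda>x. x" X W'] W(1) W'(1) by auto
  have p: "contiguous V W p p" "contiguous V W' p' p'" using carried_contiguous V(2,3) by blast+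
  show thesis
  proof
    show "V \<in> open_covers X" by fact
    show "carried g V (fst a) (\<lambda>B. t (p B))" "carried h V (fst b) (\<lambda>B. r (p B))"
      "carried g' V (fst a') (\<lambda>B. t' (p' B))" "carried h' V (fst b') (\<lambda>B. r' (p' B))"
      using carried_compose V(2,3) W(2,3) W'(2,3) by blast+
    show "(\<lambda>s. pullback V q (\<lambda>B. t (p B)) (snd a) s - pullback V q (\<lambda>B. r (p B)) (snd b) s) \<in> coboundaries V q"
      using pullback_coboundaries[OF p(1) cob] by (simp add: pullback_diff pullback_pullback[OF p(1)])
    show "(\<lambda>s. pullback V q (\<lambda>B. t' (p' B)) (snd a') s - pullback V q (\<lambda>B. r' (p' B)) (snd b') s) \<in> coboundaries V q"
      using pullback_coboundaries[OF p(2) cob'] by (simp add: pullback_diff pullback_pullback[OF p(2)])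
  qed
qed

text \<open>The middle class gets pulled back along \<open>h\<close> by two different carriers. They
  are contiguous, and as \<open>snd b\<close> is a cocycle its two pullbacks differ by a
  coboundary.\<close>

lemma pb_eq_trans:
  assumes "pb_eq X q g h a b" "pb_eq X q h k b c" "snd b \<in> cocycles (fst b) q"
  shows "pb_eq X q g k a c"
proof -
  obtain W t r t' r' where W: "W \<in> open_covers X"
    "carried g W (fst a) t" "carried h W (fst b) r" "carried h W (fst b) t'" "carried k W (fst c) r'"
    "(\<lambda>s. pullback W q t (snd a) s - pullback W q r (snd b) s) \<in> coboundaries W q"
    "(\<lambda>s. pullback W q t' (snd b) s - pullback W q r' (snd c) s) \<in> coboundaries W q"
    using pb_eq_common[OF assms(1,2)] .
  have "(\<lambda>s. pullback W q r (snd b) s - pullback W q t' (snd b) s) \<in> coboundaries W q"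
    using contiguous_coboundaries[OF carried_contiguous[OF W(3,4)] assms(3)] .
  from coboundaries_add[OF coboundaries_add[OF W(6) this] W(7)] show ?thesis
    by (intro pb_eqI[OF W(1,2,5)]) simp
qed

lemma pb_eq_add:
  assumes "pb_eq X q g h (U, c) (V, d)" "pb_eq X q g h (U, c') (V, d')"
    and "c' \<in> cocycles U q" "d' \<in> cocycles V q"
  shows "pb_eq X q g h (U, \<lambda>s. c s + c' s) (V, \<lambda>s. d s + d' s)"
proof -
  obtain W t r t' r' where W: "W \<in> open_covers X"
    "carried g W U t" "carried h W V r" "carried g W U t'" "carried h W V r'"
    "(\<lambda>s. pullback W q t c s - pullback W q r d s) \<in> coboundaries W q"
    "(\<lambda>s. pullback W q t' c' s - pullback W q r' d' s) \<in> coboundaries W q"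
    using pb_eq_common[OF assms(1,2), unfolded fst_conv snd_conv] .
  have 1: "(\<lambda>s. pullback W q t c' s - pullback W q t' c' s) \<in> coboundaries W q"
    using contiguous_coboundaries[OF carried_contiguous[OF W(2,4)] assms(3)] .
  have 2: "(\<lambda>s. pullback W q r' d' s - pullback W q r d' s) \<in> coboundaries W q"
    using contiguous_coboundaries[OF carried_contiguous[OF W(5,3)] assms(4)] .
  have "(\<lambda>s. pullback W q t (\<lambda>s. c s + c' s) s - pullback W q r (\<lambda>s. d s + d' s) s) \<in> coboundaries W q"
    using coboundaries_add[OF coboundaries_add[OF W(6) W(7)] coboundaries_add[OF 1 2]]
    by (simp add: pullback_add algebra_simps)
  then show ?thesis
    by (intro pb_eqI[OF W(1)]) (use W(2,3) in auto)
qed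

lemma pb_eq_pullback_rep:
  assumes "W \<in> open_covers X" "carried g W U t"
  shows "pb_eq X q (\<lambda>x. x) g (W, pullback W q t c) (U, c)"
proof -
  have id: "carried (\<lambda>x. x) W W (\<lambda>B. B)" by (simp add: carried_def)
  have "pullback W q (\<lambda>B. B) (pullback W q t c) = pullback W q t c"
    using pullback_pullback[OF carried_contiguous[OF id id]] by simp
  then show ?thesis
    by (intro pb_eqI[of W X _ _ "\<lambda>B. B" _ _ t]) (use assms id coboundaries_zero in auto)
qed

lemma pullback_reps:
  assumes "W \<in> open_covers X" "carried g W U t" "c \<in> cocycles U q"
  shows "(W, pullback W q t c) \<in> cech_reps X q"
  using pullback_cocycles[OF carried_contiguous[OF assms(2,2)] assms(3)] assms(1)
  by (simp add: cech_reps_def)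

text \<open>Existence of \<open>g\<^sup>* a\<close>: the cocycle is pulled back to a cover of
  \<open>X\<close> whose members map into members of the given cover.\<close>

lemma pb_rep_exists:
  assumes "continuous_on X g" "g ` X \<subseteq> Y" "a \<in> cech_reps Y q"
  obtains b where "b \<in> cech_reps X q" "pb_eq X q (\<lambda>x. x) g b a"
proof -
  obtain W t where "W \<in> open_covers X" "carried g W (fst a) t"
    using cover_pullback_exists[OF assms(1,2) cech_repsD(1)[OF assms(3)]] .
  then show thesis
    using that pullback_reps pb_eq_pullback_rep cech_repsD(2)[OF assms(3)] by (metis prod.collapse)
qed

section \<open>Restriction homomorphisms\<close>

lemma equiv_cech_rel: "equiv (cech_reps X q) (cech_rel X q)"
proof (rule equivI)
  show "cech_rel X q \<subseteq> cech_reps X q \<times> cech_reps X q"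
    by (auto simp: cech_rel_def)
  show "refl_on (cech_reps X q) (cech_rel X q)"
    by (rule refl_onI) (auto simp: cech_rel_iff intro: pb_eq_refl[where Y=X] dest: cech_repsD(1))
  show "sym (cech_rel X q)"
    by (rule symI) (auto simp: cech_rel_iff intro: pb_eq_sym)
  show "trans (cech_rel X q)"
    by (rule transI) (auto simp: cech_rel_iff intro: pb_eq_trans dest: cech_repsD(2))
qed

text \<open>The data behind the \<open>SOME\<close> in the group law of
  \<open>cech_cohomology\<close>. It is a relation because neither the common refinement nor the
  maps into the two covers are unique.\<close>

definition sum_rep :: "'a::topological_space set \<Rightarrow> nat \<Rightarrow> 'a set set \<times> ('a set list \<Rightarrow> int) \<Rightarrow>
    'a set set \<times> ('a set list \<Rightarrow> int) \<Rightarrow> 'a set set \<times> ('a set list \<Rightarrow> int) \<Rightarrow> bool" where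
  "sum_rep X q a b e \<longleftrightarrow> (\<exists>W t r. W \<in> open_covers X \<and> carried (\<lambda>x. x) W (fst a) t \<and>
     carried (\<lambda>x. x) W (fst b) r \<and> e = (W, \<lambda>s. pullback W q t (snd a) s + pullback W q r (snd b) s))"

lemma sum_rep_exists:
  assumes "a \<in> cech_reps X q" "b \<in> cech_reps X q" obtains e where "sum_rep X q a b e"
proof -
  obtain W t r where "W \<in> open_covers X" "carried (\<lambda>x. x) W (fst a) t" "carried (\<lambda>x. x) W (fst b) r"
    using common_refinement[of X "\<lambda>x. x" X "fst a" "\<lambda>x. x" X "fst b"] assms[THEN cech_repsD(1)] by auto
  then show thesis
    using that unfolding sum_rep_def by blast
qed

lemma sum_rep_reps:
  assumes "a \<in> cech_reps X q" "b \<in> cech_reps X q" "sum_rep X q a b e" shows "e \<in> cech_reps X q"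
proof -
  obtain W t r where W: "W \<in> open_covers X" "carried (\<lambda>x. x) W (fst a) t" "carried (\<lambda>x. x) W (fst b) r"
    and e: "e = (W, \<lambda>s. pullback W q t (snd a) s + pullback W q r (snd b) s)"
    using assms(3) unfolding sum_rep_def by blast
  have "(W, pullback W q t (snd a)) \<in> cech_reps X q" "(W, pullback W q r (snd b)) \<in> cech_reps X q"
    using pullback_reps[OF W(1,2)] pullback_reps[OF W(1,3)] assms(1,2)[THEN cech_repsD(2)] by simp_all
  then show ?thesis
    unfolding e by (simp add: cech_reps_def cocycles_add)
qed

text \<open>One statement for two uses: with \<open>X\<close>, \<open>Y\<close>, \<open>Z\<close>
  equal it says that addition of classes is well defined, and with \<open>Z\<close> equal to
  \<open>X\<close> that restriction from \<open>Y\<close> to \<open>X\<close> is additive.\<close>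

lemma pb_eq_sum_rep:
  assumes a: "a \<in> cech_reps Y q" "b \<in> cech_reps Y q" "sum_rep Y q a b e"
    and a': "a' \<in> cech_reps Z q" "b' \<in> cech_reps Z q" "sum_rep Z q a' b' e'"
    and X: "X \<subseteq> Y" "X \<subseteq> Z"
    and eq: "pb_eq X q (\<lambda>x. x) (\<lambda>x. x) a a'" "pb_eq X q (\<lambda>x. x) (\<lambda>x. x) b b'"
  shows "pb_eq X q (\<lambda>x. x) (\<lambda>x. x) e e'"
proof -
  obtain W t r where W: "W \<in> open_covers Y" "carried (\<lambda>x. x) W (fst a) t" "carried (\<lambda>x. x) W (fst b) r"
    and e: "e = (W, \<lambda>s. pullback W q t (snd a) s + pullback W q r (snd b) s)"
    using a(3) unfolding sum_rep_def by blast
  obtain W' t' r' where W': "W' \<in> open_covers Z" "carried (\<lambda>x. x) W' (fst a') t'" "carried (\<lambda>x. x) W' (fst b') r'"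
    and e': "e' = (W', \<lambda>s. pullback W' q t' (snd a') s + pullback W' q r' (snd b') s)"
    using a'(3) unfolding sum_rep_def by blast
  have *: "pb_eq X q (\<lambda>x. x) (\<lambda>x. x) (W, pullback W q p (snd z)) (W', pullback W' q p' (snd z'))"
    if "carried (\<lambda>x. x) W (fst z) p" "carried (\<lambda>x. x) W' (fst z') p'" "z \<in> cech_reps Y q"
      "z' \<in> cech_reps Z q" "pb_eq X q (\<lambda>x. x) (\<lambda>x. x) z z'" for z z' p p'
  proof -
    have "pb_eq X q (\<lambda>x. x) (\<lambda>x. x) (W, pullback W q p (snd z)) z"
      using pb_eq_subset[OF pb_eq_pullback_rep[OF W(1) that(1)] X(1), of q "snd z"] by simp
    moreover have "pb_eq X q (\<lambda>x. x) (\<lambda>x. x) z' (W', pullback W' q p' (snd z'))"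
      using pb_eq_sym[OF pb_eq_subset[OF pb_eq_pullback_rep[OF W'(1) that(2)] X(2), of q "snd z'"]] by simp
    ultimately show ?thesis
      using that(3-5) pb_eq_trans cech_repsD(2) by blast
  qed
  show ?thesis
    unfolding e e'
  proof (rule pb_eq_add)
    show "pullback W q r (snd b) \<in> cocycles W q" "pullback W' q r' (snd b') \<in> cocycles W' q"
      using pullback_reps[OF W(1,3)] pullback_reps[OF W'(1,3)] cech_repsD(2) a(2) a'(2)
      by (fastforce simp: cech_reps_def)+
  qed (use * W W' a a' eq in blast)+
qed

section \<open>Classes, their group law, and restriction as an isomorphism\<close>

lemma cech_carrierE:
  assumes "A \<in> carrier (cech_cohomology X q)"
  obtains a where "a \<in> cech_reps X q" "A = cech_rel X q `` {a}"
  using assms by (auto simp: cech_cohomology_def elim: quotientE)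

lemma cech_carrierI: "a \<in> cech_reps X q \<Longrightarrow> cech_rel X q `` {a} \<in> carrier (cech_cohomology X q)"
  by (simp add: cech_cohomology_def quotientI)

lemma cech_rel_class_eq_iff:
  assumes "a \<in> cech_reps X q" "b \<in> cech_reps X q"
  shows "cech_rel X q `` {a} = cech_rel X q `` {b} \<longleftrightarrow> pb_eq X q (\<lambda>x. x) (\<lambda>x. x) a b"
  using eq_equiv_class_iff[OF equiv_cech_rel assms] assms by (simp add: cech_rel_iff)

text \<open>All candidates for the \<open>SOME\<close> in the group law represent the same class, so
  the choice is forced.\<close>

lemma cech_mult:
  assumes "a \<in> cech_reps X q" "b \<in> cech_reps X q" "sum_rep X q a b e"
  shows "mult (cech_cohomology X q) (cech_rel X q `` {a}) (cech_rel X q `` {b}) = cech_rel X q `` {e}"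
proof -
  let ?S = "\<lambda>r. \<exists>a'\<in>cech_rel X q `` {a}. \<exists>b'\<in>cech_rel X q `` {b}. \<exists>e. sum_rep X q a' b' e \<and> r = cech_rel X q `` {e}"
  have S: "(\<exists>U c V d W \<tau> \<sigma>. (U, c) \<in> cech_rel X q `` {a} \<and> (V, d) \<in> cech_rel X q `` {b} \<and>
      W \<in> open_covers X \<and> refinement_map W U \<tau> \<and> refinement_map W V \<sigma> \<and>
      r = cech_class X q W (\<lambda>s. pullback W q \<tau> c s + pullback W q \<sigma> d s)) \<longleftrightarrow> ?S r" for r
    by (simp add: sum_rep_def cech_class_def refinement_map_iff_carried Bex_def) blast
  have "(SOME r. ?S r) = cech_rel X q `` {e}"
  proof (rule some_equality)
    have "a \<in> cech_rel X q `` {a}" "b \<in> cech_rel X q `` {b}"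
      using assms(1,2) equiv_class_self[OF equiv_cech_rel] by blast+
    then show "?S (cech_rel X q `` {e})" using assms(3) by blast
  next
    fix r assume "?S r"
    then obtain a' b' e' where *: "(a, a') \<in> cech_rel X q" "(b, b') \<in> cech_rel X q" "sum_rep X q a' b' e'"
      and r: "r = cech_rel X q `` {e'}" by blast
    then have a': "a' \<in> cech_reps X q" "pb_eq X q (\<lambda>x. x) (\<lambda>x. x) a a'"
      and b': "b' \<in> cech_reps X q" "pb_eq X q (\<lambda>x. x) (\<lambda>x. x) b b'"
      by (simp_all add: cech_rel_iff)
    have "pb_eq X q (\<lambda>x. x) (\<lambda>x. x) e e'" "e' \<in> cech_reps X q"
      using pb_eq_sum_rep[OF assms a'(1) b'(1) *(3) order_refl order_refl a'(2) b'(2)]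
        sum_rep_reps[OF a'(1) b'(1) *(3)] by simp_all
    then show "r = cech_rel X q `` {e}"
      using cech_rel_class_eq_iff sum_rep_reps[OF assms] r by metis
  qed
  then show ?thesis
    by (simp only: cech_cohomology_def monoid.select_convs S)
qed

theorem cech_restriction_iso:
  assumes XY: "X \<subseteq> Y"
    and surj: "\<And>b. b \<in> cech_reps X q \<Longrightarrow> \<exists>a\<in>cech_reps Y q. pb_eq X q (\<lambda>x. x) (\<lambda>x. x) a b"
    and inj: "\<And>a a'. a \<in> cech_reps Y q \<Longrightarrow> a' \<in> cech_reps Y q \<Longrightarrow> pb_eq X q (\<lambda>x. x) (\<lambda>x. x) a a'
      \<Longrightarrow> pb_eq Y q (\<lambda>x. x) (\<lambda>x. x) a a'"
  shows "cech_cohomology Y q \<cong> cech_cohomology X q"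
proof -
  \<comment> \<open>Restriction without choices: the value collects every representative on
    \<open>X\<close> that agrees there with some member of \<open>A\<close>. The fact
    \<open>h\<close> shows that this is a single class.\<close>
  define h where "h A = {b \<in> cech_reps X q. \<exists>a\<in>A. pb_eq X q (\<lambda>x. x) (\<lambda>x. x) a b}" for A
  have h: "h (cech_rel Y q `` {a}) = cech_rel X q `` {b}"
    if a: "a \<in> cech_reps Y q" and b: "b \<in> cech_reps X q" and ab: "pb_eq X q (\<lambda>x. x) (\<lambda>x. x) a b" for a b
  proof (intro equalityI subsetI)
    fix z assume "z \<in> h (cech_rel Y q `` {a})"
    then obtain a' where "z \<in> cech_reps X q" "pb_eq Y q (\<lambda>x. x) (\<lambda>x. x) a a'" "a' \<in> cech_reps Y q"
      "pb_eq X q (\<lambda>x. x) (\<lambda>x. x) a' z"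
      by (auto simp: h_def cech_rel_iff)
    then have "pb_eq X q (\<lambda>x. x) (\<lambda>x. x) b z"
      using pb_eq_subset[OF _ XY] pb_eq_sym[OF ab] a cech_repsD(2) pb_eq_trans by metis
    then show "z \<in> cech_rel X q `` {b}"
      using b \<open>z \<in> cech_reps X q\<close> by (simp add: cech_rel_iff)
  next
    fix z assume "z \<in> cech_rel X q `` {b}"
    then have "z \<in> cech_reps X q" "pb_eq X q (\<lambda>x. x) (\<lambda>x. x) a z"
      using ab pb_eq_trans[OF ab _ cech_repsD(2)[OF b]] by (auto simp: cech_rel_iff)
    then show "z \<in> h (cech_rel Y q `` {a})"
      using equiv_class_self[OF equiv_cech_rel a] by (auto simp: h_def)
  qed
  have ex: "\<exists>b\<in>cech_reps X q. pb_eq X q (\<lambda>x. x) (\<lambda>x. x) a b" if a: "a \<in> cech_reps Y q" for a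
  proof -
    obtain b where "b \<in> cech_reps X q" "pb_eq X q (\<lambda>x. x) (\<lambda>x. x) b a"
      using pb_rep_exists[OF continuous_on_id _ a, of X] XY unfolding image_ident by blast
    then show ?thesis using pb_eq_sym by blast
  qed
  have "h \<in> hom (cech_cohomology Y q) (cech_cohomology X q)"
  proof (rule homI)
    fix A assume "A \<in> carrier (cech_cohomology Y q)"
    then show "h A \<in> carrier (cech_cohomology X q)"
      using cech_carrierE h ex cech_carrierI by metis
  next
    fix A A' assume "A \<in> carrier (cech_cohomology Y q)" "A' \<in> carrier (cech_cohomology Y q)"
    then obtain a a' where a: "a \<in> cech_reps Y q" "A = cech_rel Y q `` {a}"
      and a': "a' \<in> cech_reps Y q" "A' = cech_rel Y q `` {a'}"
      by (metis cech_carrierE)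
    obtain b b' where b: "b \<in> cech_reps X q" "pb_eq X q (\<lambda>x. x) (\<lambda>x. x) a b"
      and b': "b' \<in> cech_reps X q" "pb_eq X q (\<lambda>x. x) (\<lambda>x. x) a' b'"
      using ex a(1) a'(1) by blast
    obtain e where e: "sum_rep Y q a a' e" using sum_rep_exists[OF a(1) a'(1)] .
    obtain e' where e': "sum_rep X q b b' e'" using sum_rep_exists[OF b(1) b'(1)] .
    have "pb_eq X q (\<lambda>x. x) (\<lambda>x. x) e e'"
      using pb_eq_sum_rep[OF a(1) a'(1) e b(1) b'(1) e' XY order_refl b(2) b'(2)] .
    then have "h (cech_rel Y q `` {e}) = cech_rel X q `` {e'}"
      using h sum_rep_reps[OF a(1) a'(1) e] sum_rep_reps[OF b(1) b'(1) e'] by blast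
    then show "h (A \<otimes>\<^bsub>cech_cohomology Y q\<^esub> A') = h A \<otimes>\<^bsub>cech_cohomology X q\<^esub> h A'"
      unfolding a(2) a'(2) cech_mult[OF a(1) a'(1) e] h[OF a(1) b] h[OF a'(1) b']
        cech_mult[OF b(1) b'(1) e'] .
  qed
  moreover have "inj_on h (carrier (cech_cohomology Y q))"
  proof (rule inj_onI)
    fix A A' assume "A \<in> carrier (cech_cohomology Y q)" "A' \<in> carrier (cech_cohomology Y q)" and eq: "h A = h A'"
    then obtain a a' where a: "a \<in> cech_reps Y q" "A = cech_rel Y q `` {a}"
      and a': "a' \<in> cech_reps Y q" "A' = cech_rel Y q `` {a'}"
      by (metis cech_carrierE)
    obtain b b' where b: "b \<in> cech_reps X q" "pb_eq X q (\<lambda>x. x) (\<lambda>x. x) a b"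
      and b': "b' \<in> cech_reps X q" "pb_eq X q (\<lambda>x. x) (\<lambda>x. x) a' b'"
      using ex a(1) a'(1) by blast
    have "pb_eq X q (\<lambda>x. x) (\<lambda>x. x) b b'"
      using eq h[OF a(1) b] h[OF a'(1) b'] cech_rel_class_eq_iff[OF b(1) b'(1)] a(2) a'(2) by simp
    then have "pb_eq X q (\<lambda>x. x) (\<lambda>x. x) a a'"
      using pb_eq_trans[OF pb_eq_trans[OF b(2)] pb_eq_sym[OF b'(2)]] b(1) b'(1) cech_repsD(2) by blast
    then show "A = A'"
      using inj[OF a(1) a'(1)] cech_rel_class_eq_iff[OF a(1) a'(1)] a(2) a'(2) by simp
  qed
  moreover have "h ` carrier (cech_cohomology Y q) = carrier (cech_cohomology X q)"
  proof
    show "h ` carrier (cech_cohomology Y q) \<subseteq> carrier (cech_cohomology X q)"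
      using calculation(1) by (auto simp: hom_def)
    show "carrier (cech_cohomology X q) \<subseteq> h ` carrier (cech_cohomology Y q)"
    proof
      fix B assume "B \<in> carrier (cech_cohomology X q)"
      then obtain b where b: "b \<in> cech_reps X q" "B = cech_rel X q `` {b}"
        by (rule cech_carrierE)
      then obtain a where a: "a \<in> cech_reps Y q" "pb_eq X q (\<lambda>x. x) (\<lambda>x. x) a b"
        using surj by blast
      show "B \<in> h ` carrier (cech_cohomology Y q)"
        using h[OF a(1) b(1) a(2)] cech_carrierI[OF a(1)] b(2) by (metis imageI)
    qed
  qed
  ultimately show ?thesis
    by (intro is_isoI[of h]) (simp add: iso_iff)
qed

section \<open>Homotopy invariance and continuity\<close>

text \<open>Maps that are pointwise close relative to a cover share a carrier, so a homotopy only has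
  to be followed through short time steps.\<close>
lemma pb_eq_homotopy:
  assumes "compact X" and H: "continuous_on (X \<times> {0..1::real}) (\<lambda>(x, t). H x t)"
    and HY: "\<And>x t. x \<in> X \<Longrightarrow> t \<in> {0..1} \<Longrightarrow> H x t \<in> Y" and a: "a \<in> cech_reps Y q"
  shows "pb_eq X q (\<lambda>x. H x 0) (\<lambda>x. H x 1) a a"
proof -
  \<comment> \<open>Connectedness of the interval replaces a subdivision: agreement of time slices
    is an equivalence relation on times, so it suffices to compare \<open>s\<close> with nearby
    times.\<close>
  have "pb_eq X q (\<lambda>x. H x s) (\<lambda>x. H x t) a a" if "s \<in> {0..1}" "t \<in> {0..1}" for s t
  proof (rule connected_equivalence_relation[of "{0..1}" _ _ "\<lambda>s t. pb_eq X q (\<lambda>x. H x s) (\<lambda>x. H x t) a a"])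
    fix s :: real assume s: "s \<in> {0..1}"
    define Q where "Q x A B T \<longleftrightarrow> A \<in> fst a \<and> open B \<and> x \<in> B \<and> open T \<and> s \<in> T \<and>
        (\<forall>y t. y \<in> X \<longrightarrow> y \<in> B \<longrightarrow> t \<in> {0..1} \<longrightarrow> t \<in> T \<longrightarrow> H y t \<in> A)" for x A B T
    have "\<exists>A B T. Q x A B T" if x: "x \<in> X" for x
    proof -
      obtain A where A: "A \<in> fst a" "openin (top_of_set (X \<times> {0..1})) (X \<times> {0..1} \<inter> (\<lambda>(x, t). H x t) -` A)"
        "(x, s) \<in> X \<times> {0..1} \<inter> (\<lambda>(x, t). H x t) -` A"
      proof (rule open_cover_preimage[OF _ _ cech_repsD(1)[OF a]])
        show "continuous_on (X \<times> {0..1}) (\<lambda>(x, t). H x t)" by fact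
        show "(\<lambda>(x, t). H x t) ` (X \<times> {0..1}) \<subseteq> Y" using HY by auto
        show "(x, s) \<in> X \<times> {0..1}" using x s by auto
      qed
      then obtain E where E: "open E" "X \<times> {0..1} \<inter> (\<lambda>(x, t). H x t) -` A = X \<times> {0..1} \<inter> E"
        by (auto simp: openin_open)
      have "(x, s) \<in> E" using A(3) E(2) by blast
      then obtain B T where BT: "open B" "open T" "(x, s) \<in> B \<times> T" "B \<times> T \<subseteq> E"
        using open_prod_elim[OF E(1)] by metis
      have "H y t \<in> A" if "y \<in> X" "y \<in> B" "t \<in> {0..1}" "t \<in> T" for y t
      proof -
        have "(y, t) \<in> X \<times> {0..1} \<inter> E" using that BT(4) by (simp add: subset_iff)
        then have "(y, t) \<in> (\<lambda>(x, t). H x t) -` A" using E(2) by blast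
        then show ?thesis by simp
      qed
      then show ?thesis using A(1) BT(1-3) unfolding Q_def by blast
    qed
    then obtain A B T where Q: "\<And>x. x \<in> X \<Longrightarrow> Q x (A x) (B x) (T x)"
      by metis
    have loc: "\<And>x. x \<in> X \<Longrightarrow> A x \<in> fst a" "\<And>x. x \<in> X \<Longrightarrow> open (B x)"
      "\<And>x. x \<in> X \<Longrightarrow> x \<in> B x" "\<And>x. x \<in> X \<Longrightarrow> open (T x)" "\<And>x. x \<in> X \<Longrightarrow> s \<in> T x"
      "\<And>x y t. x \<in> X \<Longrightarrow> y \<in> X \<Longrightarrow> y \<in> B x \<Longrightarrow> t \<in> {0..1} \<Longrightarrow> t \<in> T x \<Longrightarrow> H y t \<in> A x"
      using Q unfolding Q_def by simp_all
    have "X \<subseteq> (\<Union>x\<in>X. B x)" using loc(3) by auto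
    from compactE_image[OF \<open>compact X\<close> loc(2) this]
    obtain C where C: "C \<subseteq> X" "finite C" "X \<subseteq> (\<Union>x\<in>C. B x)" .
    \<comment> \<open>Compactness of \<open>X\<close> leaves finitely many time neighbourhoods to
      intersect, so one neighbourhood of \<open>s\<close> serves all points.\<close>
    have "open (\<Inter>x\<in>C. T x)" using C loc(4) by blast
    moreover have "pb_eq X q (\<lambda>x. H x s) (\<lambda>x. H x t) a a" if t: "t \<in> {0..1} \<inter> (\<Inter>x\<in>C. T x)" for t
    proof (rule local_open_cover)
      let ?P = "\<lambda>B A. A \<in> fst a \<and> (\<forall>y\<in>B. H y s \<in> A) \<and> (\<forall>y\<in>B. H y t \<in> A)"
      show "\<exists>B A. openin (top_of_set X) B \<and> x \<in> B \<and> ?P B A" if xX: "x \<in> X" for x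
      proof -
        obtain c where c: "c \<in> C" "x \<in> B c" using C(3) xX by blast
        then have cX: "c \<in> X" and "t \<in> T c" using C(1) t by auto
        then have "?P (X \<inter> B c) (A c)"
          using loc(1,5,6)[OF cX] s t by blast
        moreover have "openin (top_of_set X) (X \<inter> B c)"
          using loc(2)[OF cX] by (simp add: openin_open_Int)
        ultimately show ?thesis using c(2) xX by blast
      qed
      fix W r assume "W \<in> open_covers X" "\<And>B. B \<in> W \<Longrightarrow> ?P B (r B)"
      then show ?thesis
        by (intro pb_eq_of_carried[of W X _ _ r]) (simp_all add: carried_def)
    qed
    ultimately show "\<exists>V. openin (top_of_set {0..1}) V \<and> s \<in> V \<and> (\<forall>t\<in>V. pb_eq X q (\<lambda>x. H x s) (\<lambda>x. H x t) a a)"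
      using s loc(5) C(1) by (intro exI[of _ "{0..1} \<inter> (\<Inter>x\<in>C. T x)"]) (auto simp: openin_open_Int)
  next
    show "pb_eq X q (\<lambda>x. H x t) (\<lambda>x. H x s) a a" if "pb_eq X q (\<lambda>x. H x s) (\<lambda>x. H x t) a a" for s t
      using that by (rule pb_eq_sym)
    show "pb_eq X q (\<lambda>x. H x r) (\<lambda>x. H x t) a a"
      if "pb_eq X q (\<lambda>x. H x r) (\<lambda>x. H x s) a a" "pb_eq X q (\<lambda>x. H x s) (\<lambda>x. H x t) a a" for r s t
      using pb_eq_trans[OF that cech_repsD(2)[OF a]] .
  qed (use that in simp_all)
  then show ?thesis by simp
qed

section \<open>Separation by functions in compact Hausdorff subspaces\<close>

lemma Hausdorff_euclidean_t2: "Hausdorff_space (euclidean :: 'a::t2_space topology)"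
  using hausdorff unfolding Hausdorff_space_def disjnt_def by fastforce

text \<open>A compact Hausdorff subspace is normal, so Urysohn's lemma is applied inside
  \<open>N\<close> rather than in the ambient space.\<close>

lemma Urysohn_compact:
  fixes N :: "'a::t2_space set"
  assumes "compact N" "closed S" "closed T" "S \<inter> T = {}" "S \<subseteq> N" "T \<subseteq> N"
  obtains u :: "'a \<Rightarrow> real" where "continuous_on N u" "\<And>x. x \<in> N \<Longrightarrow> u x \<in> {0..1}"
    "\<And>x. x \<in> S \<Longrightarrow> u x = 0" "\<And>x. x \<in> T \<Longrightarrow> u x = 1"
proof -
  have "normal_space (top_of_set N)"
    using assms(1) Hausdorff_space_subtopology[OF Hausdorff_euclidean_t2]
    by (intro compact_Hausdorff_or_regular_imp_normal_space disjI1) (simp_all add: compact_space_subtopology)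
  moreover have "closedin (top_of_set N) S" "closedin (top_of_set N) T" "disjnt S T"
    using assms by (auto simp: closed_subset disjnt_def)
  ultimately obtain u where u: "continuous_map (top_of_set N) (top_of_set {0..1::real}) u"
    "u ` S \<subseteq> {0}" "u ` T \<subseteq> {1}"
    using Urysohn_lemma[of "top_of_set N" S T 0 1] by auto
  show thesis
  proof
    show "continuous_on N u"
      using u(1) continuous_map_into_fulltopology by fastforce
    show "u x \<in> {0..1}" if "x \<in> N" for x
      using continuous_map_image_subset_topspace[OF u(1)] that by auto
  qed (use u in auto)
qed

text \<open>The function on \<open>N\<close> vanishes off \<open>G \<inter> interior N\<close>, in
  particular where \<open>N\<close> meets the closed set \<open>- interior N\<close>; hence
  extension by 0 glues continuously.\<close>

lemma bump_function:
  fixes N :: "'a::t2_space set"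
  assumes "compact N" "x \<in> interior N" "open G" "x \<in> G"
  obtains u :: "'a \<Rightarrow> real" where "continuous_on UNIV u" "u x = 1" "\<And>y. y \<notin> G \<Longrightarrow> u y = 0"
proof -
  have N: "closed N" "closed (N - G \<inter> interior N)"
    using compact_imp_closed[OF assms(1)] assms(3) by (simp_all add: closed_Diff open_Int)
  obtain v :: "'a \<Rightarrow> real" where v: "continuous_on N v" "\<And>y. y \<in> N - G \<inter> interior N \<Longrightarrow> v y = 0" "v x = 1"
  proof (rule Urysohn_compact[OF assms(1) N(2) closed_singleton[of x]])
    show "(N - G \<inter> interior N) \<inter> {x} = {}" "{x} \<subseteq> N"
      using assms(2,4) interior_subset by auto
  qed auto
  have "continuous_on (N \<union> - interior N) (\<lambda>y. if y \<in> N then v y else 0)"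
    using N v by (intro continuous_on_cases) (auto simp: closed_Compl)
  moreover have "N \<union> - interior N = UNIV"
    using interior_subset by blast
  ultimately show thesis
    using that[of "\<lambda>y. if y \<in> N then v y else 0"] v assms(2) interior_subset by fastforce
qed

text \<open>A family of open sets around \<open>K\<close> is refined so finely that sets with a common point, even
  outside \<open>K\<close>, are tied to a common point of \<open>K\<close>; this compares nerves over neighbourhoods of \<open>K\<close>
  with nerves over \<open>K\<close>.\<close>
lemma star_refinement:
  fixes N :: "'a::t2_space set"
  assumes "compact N" "compact K" "K \<subseteq> interior N" "\<And>x. x \<in> K \<Longrightarrow> open (G x) \<and> x \<in> G x"
  obtains E Z i where "open E" "K \<subseteq> E" "Z \<in> open_covers E"
    "\<And>B. B \<in> Z \<Longrightarrow> i B \<in> K \<and> B \<subseteq> G (i B)"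
    "\<And>S. S \<subseteq> Z \<Longrightarrow> S \<noteq> {} \<Longrightarrow> \<Inter>S \<noteq> {} \<Longrightarrow> \<exists>x\<in>K. \<forall>B\<in>S. x \<in> G (i B)"
proof -
  have "\<exists>u :: 'a \<Rightarrow> real. continuous_on UNIV u \<and> u x = 1 \<and> (\<forall>y. y \<notin> G x \<longrightarrow> u y = 0)" if "x \<in> K" for x
    using bump_function[OF assms(1), of x "G x"] assms(3,4) that by (metis subsetD)
  then obtain u :: "'a \<Rightarrow> 'a \<Rightarrow> real" where u: "\<And>x. x \<in> K \<Longrightarrow> continuous_on UNIV (u x)"
    "\<And>x. x \<in> K \<Longrightarrow> u x x = 1" "\<And>x y. x \<in> K \<Longrightarrow> y \<notin> G x \<Longrightarrow> u x y = 0"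
    by metis
  have "open (u c -` {1/2<..})" if "c \<in> K" for c
    using u(1)[OF that] by (intro open_vimage) auto
  then obtain C where C: "C \<subseteq> K" "finite C" "K \<subseteq> (\<Union>c\<in>C. u c -` {1/2<..})"
    using compactE_image[OF assms(2), of K "\<lambda>c. u c -` {1/2<..}"] u(2) by force
  have "\<exists>c\<in>C. u c x > 1/2" if "x \<in> K" for x
  proof -
    have "x \<in> (\<Union>c\<in>C. u c -` {1/2<..})" using that C(3) by blast
    then show ?thesis by simp
  qed
  then obtain j where j: "\<And>x. x \<in> K \<Longrightarrow> j x \<in> C \<and> u (j x) x > 1/2" by metis
  \<comment> \<open>The thresholds: the bump chosen for a cell exceeds 1/2 at its centre, and each
    bump varies by less than 1/4 between a centre and a point of its cell. If two cells meet, their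
    centres differ by less than 1/2 in each bump, so the bump of one is still positive at the centre
    of the other.\<close>
  define B where "B x = (\<Inter>c\<in>C. (\<lambda>y. \<bar>u c x - u c y\<bar>) -` {..<1/4})" for x
  have openB: "open (B x)" for x
    unfolding B_def using C(1,2) u(1) by (intro open_INT ballI open_vimage) (auto intro!: continuous_intros)
  have selfB: "x \<in> B x" for x by (simp add: B_def)
  \<comment> \<open>Different points may give the same cell; \<open>p\<close> fixes one centre per
    cell, since covers are sets of sets.\<close>
  define p where "p = inv_into K B"
  have p: "p b \<in> K" "B (p b) = b" if "b \<in> B ` K" for b
    using that inv_into_into[of b B K] f_inv_into_f[of b B K] by (simp_all add: p_def)
  have BB: "\<bar>u c x - u c y\<bar> < 1/4" if "y \<in> B x" "c \<in> C" for x y c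
    using that by (auto simp: B_def)
  show thesis
  proof (rule that[of "\<Union>x\<in>K. B x" "B ` K" "j \<circ> p"])
    show "open (\<Union>x\<in>K. B x)" using openB by blast
    show "K \<subseteq> (\<Union>x\<in>K. B x)" using selfB by blast
    show "B ` K \<in> open_covers (\<Union>x\<in>K. B x)"
      using openB by (auto simp: open_covers_def intro!: open_subset)
    show "(j \<circ> p) b \<in> K \<and> b \<subseteq> G ((j \<circ> p) b)" if b: "b \<in> B ` K" for b
    proof -
      have c: "j (p b) \<in> C" "u (j (p b)) (p b) > 1/2" using j p(1)[OF b] by auto
      have "y \<in> G (j (p b))" if "y \<in> b" for y
      proof (rule ccontr)
        assume "y \<notin> G (j (p b))"
        then have "u (j (p b)) y = 0" using u(3) c(1) C(1) by blast
        moreover have "\<bar>u (j (p b)) (p b) - u (j (p b)) y\<bar> < 1/4"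
          using BB c(1) p(2)[OF b] that by simp
        ultimately show False using c(2) by simp
      qed
      then show ?thesis using c(1) C(1) by auto
    qed
    show "\<exists>x\<in>K. \<forall>b\<in>S. x \<in> G ((j \<circ> p) b)" if S: "S \<subseteq> B ` K" "S \<noteq> {}" "\<Inter>S \<noteq> {}" for S
    proof -
      obtain z where z: "\<And>b. b \<in> S \<Longrightarrow> z \<in> b" using S(3) by auto
      obtain b0 where b0: "b0 \<in> S" using S(2) by blast
      have "p b0 \<in> G (j (p b))" if b: "b \<in> S" for b
      proof (rule ccontr)
        assume "p b0 \<notin> G (j (p b))"
        moreover have c: "j (p b) \<in> C" "u (j (p b)) (p b) > 1/2" using j p(1) b S(1) by auto
        ultimately have "u (j (p b)) (p b0) = 0" using u(3) C(1) by blast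
        moreover have "\<bar>u (j (p b)) (p b) - u (j (p b)) z\<bar> < 1/4" "\<bar>u (j (p b)) (p b0) - u (j (p b)) z\<bar> < 1/4"
          using BB c(1) p(2) z b b0 S(1) by (metis subsetD)+
        ultimately show False using c(2) by linarith
      qed
      moreover have "p b0 \<in> K" using p(1) b0 S(1) by blast
      ultimately show ?thesis by auto
    qed
  qed
qed

text \<open>No map from the neighbourhood to \<open>K\<close> is at hand, so the common point of the
  image sets comes from the star property and not from the image of a point.\<close>

lemma star_refinement_contiguous:
  fixes i :: "'a set \<Rightarrow> 'a"
  assumes "\<And>B. B \<in> Z \<Longrightarrow> i B \<in> K" "\<And>x. x \<in> K \<Longrightarrow> A x \<in> U" "\<And>x. x \<in> K \<Longrightarrow> G x \<inter> K \<subseteq> A x"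
    and "\<And>S. S \<subseteq> Z \<Longrightarrow> S \<noteq> {} \<Longrightarrow> \<Inter>S \<noteq> {} \<Longrightarrow> \<exists>x\<in>K. \<forall>B\<in>S. x \<in> G (i B)"
  shows "contiguous Z U (\<lambda>B. A (i B)) (\<lambda>B. A (i B))"
  unfolding contiguous_def Un_absorb
proof (intro allI impI conjI)
  fix S assume S: "S \<subseteq> Z" "\<Inter>S \<noteq> {}"
  show "(\<lambda>B. A (i B)) ` S \<subseteq> U"
    using S(1) assms(1,2) by auto
  show "\<Inter>((\<lambda>B. A (i B)) ` S) \<noteq> {}"
  \<comment> \<open>The empty family counts as intersecting, its intersection being the whole type,
    while the star property concerns nonempty families.\<close>
  proof (cases "S = {}")
    case False
    then obtain x where x: "x \<in> K" "\<forall>B\<in>S. x \<in> G (i B)"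
      using assms(4) S by blast
    have "x \<in> A (i B)" if "B \<in> S" for B
      using assms(1)[of B] assms(3)[of "i B"] x that S(1) by blast
    then show ?thesis by auto
  qed simp
qed

text \<open>Surjectivity half of continuity. Cells that overlap, even outside \<open>K\<close>, go
  to members of the given cover with a common point, so the cocycle pulls back to \<open>E\<close>.
  Over \<open>K\<close> the same assignment carries the identity, so the class there is the given
  one.\<close>

lemma cech_extend:
  fixes N :: "'a::t2_space set"
  assumes "compact N" "compact K" "K \<subseteq> interior N" and a: "a \<in> cech_reps K q"
  obtains E b where "open E" "K \<subseteq> E" "b \<in> cech_reps E q" "pb_eq K q (\<lambda>x. x) (\<lambda>x. x) b a"
proof -
  have "\<exists>A G. A \<in> fst a \<and> x \<in> A \<and> open G \<and> G \<inter> K = A" if x: "x \<in> K" for x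
  proof -
    obtain A where "A \<in> fst a" "x \<in> A"
      using cech_repsD(1)[OF a] x unfolding open_covers_def by blast
    then show ?thesis
      using open_coversD(1)[OF cech_repsD(1)[OF a]] unfolding openin_open by blast
  qed
  then obtain A G where AG: "\<And>x. x \<in> K \<Longrightarrow> A x \<in> fst a" "\<And>x. x \<in> K \<Longrightarrow> x \<in> A x"
    "\<And>x. x \<in> K \<Longrightarrow> open (G x)" "\<And>x. x \<in> K \<Longrightarrow> G x \<inter> K = A x"
    by metis
  obtain E Z i where E: "open E" "K \<subseteq> E" "Z \<in> open_covers E"
    and i: "\<And>B. B \<in> Z \<Longrightarrow> i B \<in> K \<and> B \<subseteq> G (i B)"
    and star: "\<And>S. S \<subseteq> Z \<Longrightarrow> S \<noteq> {} \<Longrightarrow> \<Inter>S \<noteq> {} \<Longrightarrow> \<exists>x\<in>K. \<forall>B\<in>S. x \<in> G (i B)"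
    using star_refinement[OF assms(1-3), of G] AG by (metis (no_types, lifting) IntD1)
  let ?t = "\<lambda>B. A (i B)"
  have t: "contiguous Z (fst a) ?t ?t"
    using star_refinement_contiguous[of Z i K A "fst a" G] i AG(1,4) star by simp
  obtain W r where W: "W \<in> open_covers K" "carried (\<lambda>x. x) W Z r"
    using cover_pullback_exists[OF continuous_on_id _ E(3), of K] E(2) by auto
  show thesis
  proof (rule that[OF E(1,2)])
    show "(Z, pullback Z q ?t (snd a)) \<in> cech_reps E q"
      using pullback_cocycles[OF t cech_repsD(2)[OF a]] E(3) by (simp add: cech_reps_def)
    have "carried (\<lambda>x. x) W (fst a) (\<lambda>B. ?t (r B))"
      unfolding carried_def
    proof (intro ballI conjI)
      fix B assume B: "B \<in> W"
      then have rB: "r B \<in> Z" using W(2) by (simp add: carried_def)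
      then show "A (i (r B)) \<in> fst a" using i AG(1) by blast
      fix x assume x: "x \<in> B"
      then have "x \<in> r B" "x \<in> K"
        using B W(2) open_coversD(2)[OF W(1) B] by (auto simp: carried_def)
      then show "x \<in> A (i (r B))"
        using i[OF rB] AG(4) by blast
    qed
    then show "pb_eq K q (\<lambda>x. x) (\<lambda>x. x) (Z, pullback Z q ?t (snd a)) a"
      using W pullback_pullback[OF carried_contiguous[OF W(2,2)]]
      by (intro pb_eqI[of W K _ _ r _ _ "\<lambda>B. ?t (r B)"]) (auto simp: coboundaries_zero)
  qed
qed

text \<open>Injectivity half of continuity. The coboundary witnessing agreement on \<open>K\<close>
  is pulled back along a simplicial map from a cover of \<open>E\<close>, and so remains a
  coboundary there.\<close>

lemma pb_eq_nbhd:
  fixes N :: "'a::t2_space set"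
  assumes "compact N" "compact K" "K \<subseteq> interior N" and a: "a \<in> cech_reps Y q" and b: "b \<in> cech_reps Y q"
    and D: "open D" "K \<subseteq> D" "D \<subseteq> Y" and ab: "pb_eq K q (\<lambda>x. x) (\<lambda>x. x) a b"
  obtains E where "open E" "K \<subseteq> E" "E \<subseteq> D" "pb_eq E q (\<lambda>x. x) (\<lambda>x. x) a b"
proof -
  obtain W t r where W: "W \<in> open_covers K" "carried (\<lambda>x. x) W (fst a) t" "carried (\<lambda>x. x) W (fst b) r"
    and cob: "(\<lambda>s. pullback W q t (snd a) s - pullback W q r (snd b) s) \<in> coboundaries W q"
    using ab unfolding pb_eq_def by blast
  have "\<exists>A G. A \<in> W \<and> open G \<and> x \<in> G \<and> G \<inter> K \<subseteq> A \<and> G \<subseteq> t A \<inter> r A \<inter> D" if x: "x \<in> K" for x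
  proof -
    obtain A where A: "A \<in> W" "x \<in> A"
      using W(1) x unfolding open_covers_def by blast
    obtain G1 where G1: "open G1" "A = K \<inter> G1"
      using open_coversD(1)[OF W(1) A(1)] unfolding openin_open by blast
    have tr: "t A \<in> fst a" "r A \<in> fst b" "x \<in> t A" "x \<in> r A"
      using W(2,3) A by (auto simp: carried_def)
    obtain G2 where G2: "open G2" "t A = Y \<inter> G2"
      using open_coversD(1)[OF cech_repsD(1)[OF a] tr(1)] unfolding openin_open by blast
    obtain G3 where G3: "open G3" "r A = Y \<inter> G3"
      using open_coversD(1)[OF cech_repsD(1)[OF b] tr(2)] unfolding openin_open by blast
    \<comment> \<open>Intersecting with the open set \<open>D \<subseteq> Y\<close> gives an ambient
      open set inside the relatively open \<open>t A\<close> and \<open>r A\<close>; this lets the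
      composed assignments carry the identity on all of \<open>E\<close>.\<close>
    show ?thesis
      by (rule exI[of _ A], rule exI[of _ "G1 \<inter> G2 \<inter> G3 \<inter> D"])
        (use A G1 G2 G3 D tr x in \<open>auto intro!: open_Int\<close>)
  qed
  then obtain A G where AG: "\<And>x. x \<in> K \<Longrightarrow> A x \<in> W" "\<And>x. x \<in> K \<Longrightarrow> x \<in> G x"
    "\<And>x. x \<in> K \<Longrightarrow> open (G x)" "\<And>x. x \<in> K \<Longrightarrow> G x \<inter> K \<subseteq> A x"
    "\<And>x. x \<in> K \<Longrightarrow> G x \<subseteq> t (A x) \<inter> r (A x) \<inter> D"
    by metis
  obtain E Z i where E: "open E" "K \<subseteq> E" "Z \<in> open_covers E"
    and i: "\<And>B. B \<in> Z \<Longrightarrow> i B \<in> K \<and> B \<subseteq> G (i B)"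
    and star: "\<And>S. S \<subseteq> Z \<Longrightarrow> S \<noteq> {} \<Longrightarrow> \<Inter>S \<noteq> {} \<Longrightarrow> \<exists>x\<in>K. \<forall>B\<in>S. x \<in> G (i B)"
    using star_refinement[OF assms(1-3), of G] AG(2,3) by metis
  let ?p = "\<lambda>B. A (i B)"
  have p: "contiguous Z W ?p ?p"
    using star_refinement_contiguous[of Z i K A W G] i AG(1,4) star by simp
  show thesis
  proof (rule that[OF E(1,2)])
    have "B \<subseteq> D" if "B \<in> Z" for B using i[OF that] AG(5) by blast
    then show "E \<subseteq> D" using E(3) unfolding open_covers_def by blast
    have sub: "i B \<in> K" "B \<subseteq> t (?p B)" "B \<subseteq> r (?p B)" if "B \<in> Z" for B
      using i[OF that] AG(5) by blast+
    have c: "carried (\<lambda>x. x) Z (fst a) (\<lambda>B. t (?p B))" "carried (\<lambda>x. x) Z (fst b) (\<lambda>B. r (?p B))"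
      using sub W(2,3) AG(1) unfolding carried_def by (meson subsetD)+
    show "pb_eq E q (\<lambda>x. x) (\<lambda>x. x) a b"
      using pullback_coboundaries[OF p cob]
      by (intro pb_eqI[OF E(3) c]) (simp add: pullback_diff pullback_pullback[OF p])
  qed
qed

section \<open>Forward and backward trapped points\<close>

text \<open>For compact \<open>P\<close>, \<open>fwd f P\<close> and \<open>bwd f P\<close> are the
  local stable and unstable sets of \<open>Inv f P\<close>.\<close>

definition fwd :: "('a \<Rightarrow> real \<Rightarrow> 'a) \<Rightarrow> 'a set \<Rightarrow> 'a set" where
  "fwd f P = {x. \<forall>t\<ge>0. f x t \<in> P}"

definition bwd :: "('a \<Rightarrow> real \<Rightarrow> 'a) \<Rightarrow> 'a set \<Rightarrow> 'a set" where
  "bwd f P = {x. \<forall>t\<le>0. f x t \<in> P}"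

text \<open>Time reversal exchanges \<open>fwd\<close> with \<open>bwd\<close> and keeps
  \<open>Inv\<close>, so each backward statement is a forward one for the reversed flow.\<close>

definition rev_flow :: "('a \<Rightarrow> real \<Rightarrow> 'a) \<Rightarrow> 'a \<Rightarrow> real \<Rightarrow> 'a" where
  "rev_flow f x t = f x (- t)"

lemma Inv_eq_fwd_bwd: "Inv f P = fwd f P \<inter> bwd f P"
  unfolding Inv_def fwd_def bwd_def using linear by blast

lemma Inv_mono: "P \<subseteq> Q \<Longrightarrow> Inv f P \<subseteq> Inv f Q"
  unfolding Inv_def by blast

lemma rev_flow_rev_flow [simp]: "rev_flow (rev_flow f) = f"
  by (simp add: rev_flow_def fun_eq_iff)

lemma bwd_eq_fwd_rev: "bwd f P = fwd (rev_flow f) P"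
  unfolding fwd_def bwd_def rev_flow_def
  by (metis (mono_tags, lifting) minus_minus neg_0_le_iff_le)

lemma Inv_rev: "Inv (rev_flow f) P = Inv f P"
  unfolding Inv_def rev_flow_def by (metis minus_minus)

lemma invariant_rev: "invariant_set (rev_flow f) K \<longleftrightarrow> invariant_set f K"
  unfolding invariant_set_def rev_flow_def by (metis minus_minus)

lemma flowD:
  assumes "is_flow f"
  shows "f x 0 = x" "f (f x t) s = f x (t + s)" "continuous_on S (\<lambda>p. f (fst p) (snd p))"
  using assms continuous_on_subset[of UNIV _ S] by (auto simp: is_flow_def case_prod_unfold)

lemma flow_continuous:
  assumes "is_flow f" "continuous_on S g" "continuous_on S h"
  shows "continuous_on S (\<lambda>x. f (g x) (h x))"
  using continuous_on_compose2[OF flowD(3)[OF assms(1), of UNIV], of S "\<lambda>x. (g x, h x)"] assms(2,3)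
  by (simp add: continuous_on_Pair)

lemma is_flow_rev: "is_flow f \<Longrightarrow> is_flow (rev_flow f)"
  using flow_continuous[of f UNIV fst "\<lambda>p. - snd p"]
  by (simp add: is_flow_def rev_flow_def case_prod_unfold continuous_intros)

lemma family_rev: "continuous_family_of_flows \<phi> \<Longrightarrow> continuous_family_of_flows (\<lambda>l. rev_flow (\<phi> l))"
proof -
  assume \<phi>: "continuous_family_of_flows \<phi>"
  have "continuous_on (UNIV \<times> UNIV \<times> {0..1}) (\<lambda>p. \<phi> (snd (snd p)) (fst p) (fst (snd p)))"
    using \<phi> by (simp add: continuous_family_of_flows_def case_prod_unfold)
  then have "continuous_on (UNIV \<times> UNIV \<times> {0..1}) (\<lambda>p. \<phi> (snd (snd p)) (fst p) (- fst (snd p)))"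
    using continuous_on_compose2[of "UNIV \<times> UNIV \<times> {0..1}"
        "\<lambda>p. \<phi> (snd (snd p)) (fst p) (fst (snd p))" "UNIV \<times> UNIV \<times> {0..1}"
        "\<lambda>p. (fst p, - fst (snd p), snd (snd p))"]
    by (force intro!: continuous_intros)
  moreover have "\<forall>l\<in>{0..1}. is_flow (rev_flow (\<phi> l))"
    using \<phi> is_flow_rev unfolding continuous_family_of_flows_def by blast
  ultimately show ?thesis
    by (simp add: continuous_family_of_flows_def case_prod_unfold rev_flow_def)
qed

section \<open>Elementary properties of trapped sets\<close>

lemma fwd_subset: "is_flow f \<Longrightarrow> fwd f P \<subseteq> P" and bwd_subset: "is_flow f \<Longrightarrow> bwd f P \<subseteq> P"
  and Inv_subset: "is_flow f \<Longrightarrow> Inv f P \<subseteq> P"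
  unfolding fwd_def bwd_def Inv_def by (metis (mono_tags, lifting) flowD(1) mem_Collect_eq order_refl subsetI)+

lemma fwd_flow: "is_flow f \<Longrightarrow> x \<in> fwd f P \<Longrightarrow> t \<ge> 0 \<Longrightarrow> f x t \<in> fwd f P"
  and bwd_flow: "is_flow f \<Longrightarrow> x \<in> bwd f P \<Longrightarrow> t \<le> 0 \<Longrightarrow> f x t \<in> bwd f P"
  and Inv_flow: "is_flow f \<Longrightarrow> x \<in> Inv f P \<Longrightarrow> f x t \<in> Inv f P"
  by (auto simp: fwd_def bwd_def Inv_def flowD(2))

lemma invariant_Inv: "is_flow f \<Longrightarrow> invariant_set f (Inv f P)"
  by (simp add: invariant_set_def Inv_flow)

lemma invariant_subset_Inv: "invariant_set f K \<Longrightarrow> K \<subseteq> P \<Longrightarrow> K \<subseteq> Inv f P"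
  unfolding invariant_set_def Inv_def by blast

lemma closed_fwd: "is_flow f \<Longrightarrow> closed P \<Longrightarrow> closed (fwd f P)"
proof -
  assume f: "is_flow f" and "closed P"
  have "fwd f P = (\<Inter>t\<in>{0..}. (\<lambda>x. f x t) -` P)"
    by (auto simp: fwd_def)
  also have "closed \<dots>"
    using \<open>closed P\<close> flow_continuous[OF f] by (intro closed_INT ballI closed_vimage) (auto intro: continuous_intros)
  finally show ?thesis .
qed

lemma closed_bwd: "is_flow f \<Longrightarrow> closed P \<Longrightarrow> closed (bwd f P)"
  by (simp add: bwd_eq_fwd_rev closed_fwd is_flow_rev)

lemma compact_fwd_bwd_Inv:
  fixes f :: "'a::t2_space \<Rightarrow> real \<Rightarrow> 'a"
  assumes "is_flow f" "compact P"
  shows "compact (fwd f P)" "compact (bwd f P)" "compact (Inv f P)"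
proof -
  have "closed P" using assms(2) by (rule compact_imp_closed)
  then have c: "closed (fwd f P)" "closed (bwd f P)" using closed_fwd closed_bwd assms(1) by blast+
  have "fwd f P = P \<inter> fwd f P" "bwd f P = P \<inter> bwd f P" using fwd_subset bwd_subset assms(1) by blast+
  then show "compact (fwd f P)" "compact (bwd f P)" using c assms(2) by (metis compact_Int_closed)+
  then show "compact (Inv f P)" using c(2) by (simp add: Inv_eq_fwd_bwd compact_Int_closed)
qed

text \<open>Every point of \<open>P - U\<close> is outside \<open>P\<close> at some time, possibly a
  negative one, and by compactness finitely many times \<open>D\<close> detect all of them. At time
  \<open>t \<ge> - d\<close> a forward trapped orbit is still in \<open>P\<close> after the further
  time \<open>d\<close>, so it is not in \<open>P - U\<close>.\<close>

lemma fwd_attracted: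
  fixes f :: "'a::t2_space \<Rightarrow> real \<Rightarrow> 'a"
  assumes f: "is_flow f" and P: "compact P" and U: "open U" "Inv f P \<subseteq> U"
  obtains T where "T \<ge> 0" "\<And>x t. x \<in> fwd f P \<Longrightarrow> t \<ge> T \<Longrightarrow> f x t \<in> U"
proof -
  have c: "closed ((\<lambda>x. f x t) -` P)" for t
    using compact_imp_closed[OF P] flow_continuous[OF f] by (intro closed_vimage) (auto intro: continuous_intros)
  have "(P - U) \<inter> \<Inter>(range (\<lambda>t. (\<lambda>x. f x t) -` P)) = {}"
    using U(2) by (auto simp: Inv_def)
  moreover have "compact (P - U)" using P U(1) by (rule compact_diff)
  ultimately obtain F where F: "finite F" "F \<subseteq> range (\<lambda>t. (\<lambda>x. f x t) -` P)" "(P - U) \<inter> \<Inter>F = {}"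
    using compact_imp_fip[of "P - U" "range (\<lambda>t. (\<lambda>x. f x t) -` P)"] c by (metis (no_types, lifting) imageE)
  then obtain D where D: "finite D" "F = (\<lambda>t. (\<lambda>x. f x t) -` P) ` D"
    by (metis finite_subset_image subset_UNIV)
  \<comment> \<open>Inserting 0 keeps the maximum defined and \<open>T\<close> nonnegative even when
    \<open>D\<close> is empty.\<close>
  define T where "T = Max (insert 0 (uminus ` D))"
  have T: "T \<ge> 0" "\<And>d. d \<in> D \<Longrightarrow> - d \<le> T"
    using D(1) by (auto simp: T_def)
  show thesis
  proof (rule that[OF T(1)])
    fix x t assume x: "x \<in> fwd f P" and t: "T \<le> t"
    have "f (f x t) d \<in> P" if "d \<in> D" for d
      using x T(2)[OF that] t by (simp add: flowD(2)[OF f] fwd_def)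
    then have "f x t \<in> \<Inter>F" by (simp add: D(2))
    moreover have "f x t \<in> P" using x t T(1) by (simp add: fwd_def)
    ultimately show "f x t \<in> U" using F(3) by blast
  qed
qed

text \<open>Beyond \<open>T\<close> uniform attraction applies to all of \<open>fwd f P\<close>; on
  the compact time interval up to \<open>T\<close> the tube lemma applies around points of
  \<open>Inv f P\<close>, whose whole orbits lie in \<open>U\<close>.\<close>

lemma fwd_stable:
  fixes f :: "'a::t2_space \<Rightarrow> real \<Rightarrow> 'a"
  assumes f: "is_flow f" and P: "compact P" and U: "open U" "Inv f P \<subseteq> U"
  obtains V where "open V" "Inv f P \<subseteq> V" "\<And>x t. x \<in> V \<inter> fwd f P \<Longrightarrow> t \<ge> 0 \<Longrightarrow> f x t \<in> U"
proof -
  obtain T where T: "T \<ge> 0" "\<And>x t. x \<in> fwd f P \<Longrightarrow> t \<ge> T \<Longrightarrow> f x t \<in> U"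
    using fwd_attracted[OF assms] by blast
  define W where "W = (\<lambda>p. f (fst p) (snd p)) -` U"
  have W: "open W"
    unfolding W_def using U(1) flowD(3)[OF f] by (rule open_vimage)
  define V where "V = \<Union>{X. open X \<and> X \<times> {0..T} \<subseteq> W}"
  show thesis
  proof
    show "open V" unfolding V_def by blast
    show "Inv f P \<subseteq> V"
    proof
      fix x assume "x \<in> Inv f P"
      then have "{x} \<times> {0..T} \<subseteq> W"
        using subsetD[OF U(2) Inv_flow[OF f]] by (auto simp: W_def)
      then show "x \<in> V"
        using Elementary_Topology.tube_lemma[of "{0..T}" W x] W unfolding V_def by auto
    qed
    fix x t assume x: "x \<in> V \<inter> fwd f P" and t: "(t::real) \<ge> 0"
    show "f x t \<in> U"
    proof (cases "t \<le> T")
      case True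
      have "(x, t) \<in> W" using x t True unfolding V_def by auto
      then show ?thesis by (simp add: W_def)
    qed (use x T(2) in auto)
  qed
qed

text \<open>Near \<open>Inv f P\<close> each point lies in \<open>P\<close>, hence in one of the two
  trapped sets, and stability within that set keeps the corresponding half-orbit in
  \<open>U\<close>.\<close>

lemma non_saddle_Inv:
  fixes f :: "'a::t2_space \<Rightarrow> real \<Rightarrow> 'a"
  assumes f: "is_flow f" and P: "compact P" "P \<subseteq> fwd f P \<union> bwd f P" "Inv f P \<subseteq> interior P"
  shows "non_saddle f (Inv f P)"
  unfolding non_saddle_def
proof (intro conjI allI impI)
  show "compact (Inv f P)" "invariant_set f (Inv f P)"
    using compact_fwd_bwd_Inv(3)[OF f P(1)] invariant_Inv[OF f] by auto
  fix U assume U: "Inv f P \<subseteq> interior U"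
  obtain V1 where V1: "open V1" "Inv f P \<subseteq> V1" "\<And>x t. x \<in> V1 \<inter> fwd f P \<Longrightarrow> t \<ge> 0 \<Longrightarrow> f x t \<in> interior U"
    using fwd_stable[OF f P(1) open_interior U] by blast
  obtain V2 where V2: "open V2" "Inv f P \<subseteq> V2" "\<And>x t. x \<in> V2 \<inter> bwd f P \<Longrightarrow> t \<ge> 0 \<Longrightarrow> f x (- t) \<in> interior U"
    using fwd_stable[OF is_flow_rev[OF f] P(1) open_interior, unfolded Inv_rev, OF U]
    unfolding bwd_eq_fwd_rev[symmetric] rev_flow_def by blast
  let ?V = "V1 \<inter> V2 \<inter> interior P \<inter> interior U"
  have "Inv f P \<subseteq> interior ?V"
    using V1(1,2) V2(1,2) P(3) U by (simp add: interior_open open_Int)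
  moreover have "(\<forall>t\<ge>0. f x t \<in> U) \<or> (\<forall>t\<le>0. f x t \<in> U)" if x: "x \<in> ?V" for x
  proof -
    have "x \<in> fwd f P \<or> x \<in> bwd f P" using x P(2) interior_subset by blast
    then show ?thesis
    proof
      assume "x \<in> fwd f P"
      then show ?thesis using V1(3)[of x] x interior_subset by blast
    next
      assume "x \<in> bwd f P"
      then have "f x t \<in> U" if "t \<le> 0" for t
        using V2(3)[of x "- t"] x that interior_subset by auto
      then show ?thesis by blast
    qed
  qed
  ultimately show "\<exists>V. Inv f P \<subseteq> interior V \<and> V \<subseteq> U \<and> (\<forall>x\<in>V. (\<forall>t\<ge>0. f x t \<in> U) \<or> (\<forall>t\<le>0. f x t \<in> U))"
    using interior_subset by (intro exI[of _ ?V]) blast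
qed

text \<open>Points of \<open>fwd f P\<close> are pushed forwards and points of \<open>bwd f P\<close> backwards, for a time that
  vanishes on \<open>Inv f P\<close>, where the two sets meet.\<close>
lemma deformation:
  fixes f :: "'a::t2_space \<Rightarrow> real \<Rightarrow> 'a"
  assumes f: "is_flow f" and P: "compact P" "P \<subseteq> fwd f P \<union> bwd f P" and U: "open U" "Inv f P \<subseteq> U"
  obtains H where "continuous_on (P \<times> {0..1::real}) (\<lambda>(x, s). H x s)"
    "\<And>x. x \<in> P \<Longrightarrow> H x 0 = x" "\<And>x. x \<in> P \<Longrightarrow> H x 1 \<in> U"
    "\<And>x s. x \<in> P \<Longrightarrow> s \<in> {0..1} \<Longrightarrow> H x s \<in> P" "\<And>x s. x \<in> Inv f P \<Longrightarrow> H x s = x"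
proof -
  have r: "is_flow (rev_flow f)" "Inv (rev_flow f) P \<subseteq> U"
    using is_flow_rev[OF f] U(2) by (simp_all add: Inv_rev)
  obtain T1 where T1: "T1 \<ge> 0" "\<And>x t. x \<in> fwd f P \<Longrightarrow> t \<ge> T1 \<Longrightarrow> f x t \<in> U"
    using fwd_attracted[OF f P(1) U] by blast
  obtain T2 where T2: "T2 \<ge> 0" "\<And>x t. x \<in> bwd f P \<Longrightarrow> t \<ge> T2 \<Longrightarrow> f x (- t) \<in> U"
    using fwd_attracted[OF r(1) P(1) U(1) r(2)] unfolding bwd_eq_fwd_rev[symmetric] rev_flow_def by blast
  obtain V1 where V1: "open V1" "Inv f P \<subseteq> V1" "\<And>x t. x \<in> V1 \<inter> fwd f P \<Longrightarrow> t \<ge> 0 \<Longrightarrow> f x t \<in> U"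
    using fwd_stable[OF f P(1) U] by blast
  obtain V2 where V2: "open V2" "Inv f P \<subseteq> V2" "\<And>x t. x \<in> V2 \<inter> bwd f P \<Longrightarrow> t \<ge> 0 \<Longrightarrow> f x (- t) \<in> U"
    using fwd_stable[OF r(1) P(1) U(1) r(2)] unfolding bwd_eq_fwd_rev[symmetric] rev_flow_def Inv_rev[unfolded rev_flow_def] by blast
  obtain \<rho> :: "'a \<Rightarrow> real" where \<rho>: "continuous_on P \<rho>" "\<And>x. x \<in> P \<Longrightarrow> \<rho> x \<in> {0..1}"
    "\<And>x. x \<in> Inv f P \<Longrightarrow> \<rho> x = 0" "\<And>x. x \<in> P - V1 \<inter> V2 \<Longrightarrow> \<rho> x = 1"
  proof (rule Urysohn_compact[OF P(1)])
    show "closed (Inv f P)" using compact_fwd_bwd_Inv(3)[OF f P(1)] by (rule compact_imp_closed)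
    show "closed (P - V1 \<inter> V2)" using compact_imp_closed[OF P(1)] V1(1) V2(1) by (simp add: closed_Diff open_Int)
    show "Inv f P \<inter> (P - V1 \<inter> V2) = {}" using V1(2) V2(2) by blast
    show "Inv f P \<subseteq> P" by (rule Inv_subset[OF f])
  qed auto
  define T where "T = max T1 T2"
  define u where "u x = (if x \<in> fwd f P then T * \<rho> x else - T * \<rho> x)" for x
  have T: "T \<ge> 0" "T \<ge> T1" "T \<ge> T2" using T1(1) by (auto simp: T_def)
  have P_eq: "P = fwd f P \<union> bwd f P" using P(2) fwd_subset[OF f] bwd_subset[OF f] by blast
  have "continuous_on (fwd f P \<union> bwd f P) u"
    unfolding u_def
  proof (rule continuous_on_cases)
    show "closed (fwd f P)" "closed (bwd f P)"
      using closed_fwd[OF f] closed_bwd[OF f] compact_imp_closed[OF P(1)] by auto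
    show "continuous_on (fwd f P) (\<lambda>x. T * \<rho> x)" "continuous_on (bwd f P) (\<lambda>x. - T * \<rho> x)"
      using continuous_on_subset[OF \<rho>(1)] fwd_subset[OF f] bwd_subset[OF f]
      by (auto intro!: continuous_intros)
    show "\<forall>x. x \<in> fwd f P \<and> x \<notin> fwd f P \<or> x \<in> bwd f P \<and> x \<in> fwd f P \<longrightarrow> T * \<rho> x = - T * \<rho> x"
      using \<rho>(3) by (auto simp: Inv_eq_fwd_bwd)
  qed
  then have u: "continuous_on P u" using P_eq by simp
  have uf: "u x \<ge> 0" if "x \<in> fwd f P" for x
    using that \<rho>(2)[of x] T(1) subsetD[OF fwd_subset[OF f] that] by (simp add: u_def)
  have ub: "u x \<le> 0 \<and> x \<in> bwd f P" if "x \<in> P" "x \<notin> fwd f P" for x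
    using that \<rho>(2)[of x] T(1) P(2) by (auto simp: u_def)
  show thesis
  proof (rule that[of "\<lambda>x s. f x (s * u x)"])
    have "continuous_on (P \<times> {0..1}) (\<lambda>p. u (fst p))"
      by (rule continuous_on_compose2[OF u]) (auto intro: continuous_intros)
    then show "continuous_on (P \<times> {0..1}) (\<lambda>(x, s). f x (s * u x))"
      unfolding case_prod_unfold by (intro flow_continuous[OF f] continuous_intros)
    show "f x (0 * u x) = x" for x by (simp add: flowD(1)[OF f])
    show "f x (s * u x) = x" if "x \<in> Inv f P" for x s
      using \<rho>(3)[OF that] by (simp add: u_def flowD(1)[OF f])
    show "f x (s * u x) \<in> P" if x: "x \<in> P" and s: "s \<in> {0..1}" for x s
    proof (cases "x \<in> fwd f P")
      case True
      then show ?thesis using uf[OF True] s by (simp add: fwd_def)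
    next
      case False
      then have "s * u x \<le> 0" "x \<in> bwd f P"
        using ub[OF x False] s by (auto simp: mult_nonneg_nonpos)
      then show ?thesis by (simp add: bwd_def)
    qed
    \<comment> \<open>On \<open>V1 \<inter> V2\<close> an orbit stays in \<open>U\<close> for every
      time in its own direction; elsewhere \<open>\<rho>\<close> is 1 and the full time
      \<open>T\<close> meets both bounds \<open>T1\<close> and \<open>T2\<close>.\<close>
    show "f x (1 * u x) \<in> U" if x: "x \<in> P" for x
    proof (cases "x \<in> V1 \<inter> V2")
      case True
      show ?thesis
      proof (cases "x \<in> fwd f P")
        case fx: True
        then show ?thesis using V1(3)[of x "u x"] True uf by simp
      next
        case False
        then show ?thesis using V2(3)[of x "- u x"] True ub[OF x False] by simp
      qed
    next
      case False
      then have "\<rho> x = 1" using \<rho>(4) x by blast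
      then show ?thesis
        using T1(2)[of x T] T2(2)[of x T] T ub[OF x] by (auto simp: u_def)
    qed
  qed
qed

section \<open>Perturbing the flow\<close>

text \<open>Tube lemma with the parameter as the small factor: an open condition that holds on the
  compact \<open>S\<close> at parameter 0 persists uniformly. The bound \<open>d \<le> 1\<close>
  keeps \<open>l\<close> where the flows are given.\<close>

lemma small_parameter:
  fixes E :: "('c::topological_space \<times> real) set"
  assumes "compact S" "openin (top_of_set (UNIV \<times> {0..1})) E" "\<And>y. y \<in> S \<Longrightarrow> (y, 0) \<in> E"
  obtains d where "0 < d" "d \<le> 1" "\<And>l y. l \<in> {0..<d} \<Longrightarrow> y \<in> S \<Longrightarrow> (y, l) \<in> E"
proof -
  obtain D where D: "open D" "E = (UNIV \<times> {0..1}) \<inter> D"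
    using assms(2) unfolding openin_open by blast
  have "open (prod.swap -` D)"
    using D(1) by (intro open_vimage) (auto simp: prod.swap_def intro!: continuous_intros)
  moreover have "{0} \<times> S \<subseteq> prod.swap -` D"
    using assms(3) D(2) by auto
  ultimately obtain X where X: "0 \<in> X" "open X" "X \<times> S \<subseteq> prod.swap -` D"
    using Elementary_Topology.tube_lemma[OF assms(1), of "prod.swap -` D" 0] by metis
  obtain e where e: "e > 0" "ball 0 e \<subseteq> X"
    using X(1,2) open_contains_ball by blast
  show thesis
  proof (rule that[of "min e 1"])
    fix l y assume l: "l \<in> {0..<min e 1}" and y: "y \<in> S"
    then have "l \<in> X" using e(2) by (auto simp: subset_iff)
    then have "(l, y) \<in> prod.swap -` D" using X(3) y by blast
    then show "(y, l) \<in> E" using D(2) l by auto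
  qed (use e in auto)
qed

lemma family_openin:
  assumes "continuous_family_of_flows \<phi>" "open D"
  shows "openin (top_of_set (UNIV \<times> {0..1})) {((x, t), l). l \<in> {0..1} \<and> \<phi> l x t \<in> D}"
    and "openin (top_of_set (UNIV \<times> {0..1})) {(x, l). l \<in> {0..1} \<and> \<phi> l x t \<in> D}"
proof -
  have c: "continuous_on (UNIV \<times> UNIV \<times> {0..1}) (\<lambda>p. \<phi> (snd (snd p)) (fst p) (fst (snd p)))"
    using assms(1) by (simp add: continuous_family_of_flows_def case_prod_unfold)
  have "continuous_on (UNIV \<times> {0..1}) (\<lambda>p. \<phi> (snd p) (fst (fst p)) (snd (fst p)))"
    using continuous_on_compose2[OF c, of "UNIV \<times> {0..1}" "\<lambda>p. (fst (fst p), snd (fst p), snd p)"]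
    by (force intro!: continuous_intros)
  from continuous_openin_preimage_gen[OF this assms(2)]
  show "openin (top_of_set (UNIV \<times> {0..1})) {((x, t), l). l \<in> {0..1} \<and> \<phi> l x t \<in> D}"
    by (rule back_subst) auto
  have "continuous_on (UNIV \<times> {0..1}) (\<lambda>p. \<phi> (snd p) (fst p) t)"
    using continuous_on_compose2[OF c, of "UNIV \<times> {0..1}" "\<lambda>p. (fst p, t, snd p)"]
    by (force intro!: continuous_intros)
  from continuous_openin_preimage_gen[OF this assms(2)]
  show "openin (top_of_set (UNIV \<times> {0..1})) {(x, l). l \<in> {0..1} \<and> \<phi> l x t \<in> D}"
    by (rule back_subst) auto
qed

text \<open>Under the unperturbed flow each point of the compact set \<open>N - U\<close> is outside
  \<open>N\<close> at some time. Being outside at a given time is open in point and parameter, so it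
  persists on all of \<open>N - U\<close>.\<close>

lemma Inv_upper_semicontinuous:
  fixes \<phi> :: "real \<Rightarrow> 'a::t2_space \<Rightarrow> real \<Rightarrow> 'a"
  assumes \<phi>: "continuous_family_of_flows \<phi>" and N: "compact N" and U: "open U" "Inv (\<phi> 0) N \<subseteq> U"
  obtains d where "0 < d" "d \<le> 1" "\<And>l. l \<in> {0..<d} \<Longrightarrow> Inv (\<phi> l) N \<subseteq> U"
proof -
  let ?E = "\<Union>t. {(x, l). l \<in> {0..1} \<and> \<phi> l x t \<in> - N}"
  have "openin (top_of_set (UNIV \<times> {0..1})) ?E"
    using family_openin(2)[OF \<phi>, of "- N"] compact_imp_closed[OF N] by (intro openin_Union) auto
  moreover have "(y, 0) \<in> ?E" if "y \<in> N - U" for y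
    using that U(2) by (auto simp: Inv_def)
  moreover have "compact (N - U)" using N U(1) by (rule compact_diff)
  ultimately obtain d where d: "0 < d" "d \<le> 1" "\<And>l y. l \<in> {0..<d} \<Longrightarrow> y \<in> N - U \<Longrightarrow> (y, l) \<in> ?E"
    using small_parameter by blast
  show thesis
  proof (rule that[OF d(1,2)])
    fix l assume l: "l \<in> {0..<d}"
    then have f: "is_flow (\<phi> l)" using \<phi> d(2) by (auto simp: continuous_family_of_flows_def)
    show "Inv (\<phi> l) N \<subseteq> U"
      using d(3)[OF l] Inv_subset[OF f, of N] by (fastforce simp: Inv_def)
  qed
qed

text \<open>\<open>K\<close> and \<open>N - G \<inter> interior N\<close> are disjoint compact sets;
  removing from \<open>N\<close> an open set around the latter leaves a compact neighbourhood of
  \<open>K\<close> inside \<open>G\<close>.\<close>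

lemma compact_neighbourhood:
  fixes N :: "'a::t2_space set"
  assumes "compact N" "compact K" "K \<subseteq> interior N" "open G" "K \<subseteq> G"
  obtains C where "compact C" "K \<subseteq> interior C" "C \<subseteq> G" "C \<subseteq> N"
proof -
  let ?R = "N - G \<inter> interior N"
  have R: "compact ?R" using assms(1,4) by (simp add: compact_diff open_Int)
  moreover have "disjnt K ?R" using assms(3,5) by (auto simp: disjnt_def)
  ultimately obtain A B where AB: "open A" "open B" "K \<subseteq> A" "?R \<subseteq> B" "disjnt A B"
    using assms(2) Hausdorff_space_compact_sets[of "euclidean :: 'a topology"] Hausdorff_euclidean_t2
    by (metis compactin_euclidean_iff open_openin)
  show thesis
  proof
    show "compact (N - B)" using assms(1) AB(2) by (rule compact_diff)
    have "A \<inter> interior N \<subseteq> N - B" using AB(5) interior_subset by (auto simp: disjnt_def)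
    then have "A \<inter> interior N \<subseteq> interior (N - B)"
      using AB(1) by (simp add: interior_maximal open_Int)
    then show "K \<subseteq> interior (N - B)" using AB(3) assms(3) by blast
    show "N - B \<subseteq> G" "N - B \<subseteq> N" using AB(4) by auto
  qed
qed

text \<open>\<open>K\<close> separates \<open>fwd f P\<close> from \<open>bwd f P\<close> inside \<open>P\<close>. As \<open>K\<close> is invariant for the perturbed flow too,
  perturbed orbits cannot change sides while they stay in \<open>P\<close>.\<close>
lemma fwd_persists:
  fixes \<phi> :: "real \<Rightarrow> 'a::t2_space \<Rightarrow> real \<Rightarrow> 'a"
  assumes \<phi>: "continuous_family_of_flows \<phi>" and K: "\<And>l. l \<in> {0..1} \<Longrightarrow> invariant_set (\<phi> l) K"
    and P: "compact P" "P \<subseteq> fwd (\<phi> 0) P \<union> bwd (\<phi> 0) P" "Inv (\<phi> 0) P = K" "K \<subseteq> interior P"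
    and C: "compact C" "K \<subseteq> interior C" "\<And>x t. x \<in> C \<inter> fwd (\<phi> 0) P \<Longrightarrow> t \<ge> 0 \<Longrightarrow> \<phi> 0 x t \<in> interior P"
  obtains d where "0 < d" "d \<le> 1" "\<And>l. l \<in> {0..<d} \<Longrightarrow> C \<inter> fwd (\<phi> 0) P \<subseteq> fwd (\<phi> l) P"
proof -
  have fl: "is_flow (\<phi> l)" if "l \<in> {0..1}" for l
    using \<phi> that by (simp add: continuous_family_of_flows_def)
  have f0: "is_flow (\<phi> 0)" using fl by simp
  let ?F = "fwd (\<phi> 0) P" and ?B = "bwd (\<phi> 0) P"
  obtain T where T: "T \<ge> 0" "\<And>x t. x \<in> ?F \<Longrightarrow> t \<ge> T \<Longrightarrow> \<phi> 0 x t \<in> interior C"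
    using fwd_attracted[OF f0 P(1) open_interior] C(2) P(3) by metis
  \<comment> \<open>The extra 1 makes \<open>T'\<close> positive even when \<open>T\<close> is 0, so
    that its multiples reach every time.\<close>
  define T' where "T' = T + 1"
  have T': "T' > 0" "\<And>x. x \<in> ?F \<Longrightarrow> \<phi> 0 x T' \<in> interior C"
    using T by (auto simp: T'_def)
  have cS: "compact (C \<inter> ?F)"
    using C(1) closed_fwd[OF f0] compact_imp_closed[OF P(1)] by (simp add: compact_Int_closed)
  \<comment> \<open>Perturbed orbits are controlled only on the compact time interval up to
    \<open>T'\<close>. The second bound \<open>d2\<close> brings them back to \<open>C\<close> at
    time \<open>T'\<close>, where the control can start again.\<close>
  obtain d1 where d1: "0 < d1" "d1 \<le> 1" "\<And>l y. l \<in> {0..<d1} \<Longrightarrow> y \<in> (C \<inter> ?F) \<times> {0..T'} \<Longrightarrow>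
      (y, l) \<in> {((x, t), l). l \<in> {0..1} \<and> \<phi> l x t \<in> interior P}"
  proof (rule small_parameter[OF compact_Times[OF cS compact_Icc] family_openin(1)[OF \<phi> open_interior]])
    show "(y, 0) \<in> {((x, t), l). l \<in> {0..1} \<and> \<phi> l x t \<in> interior P}" if "y \<in> (C \<inter> ?F) \<times> {0..T'}" for y
      using that C(3) by auto
  qed blast
  obtain d2 where d2: "0 < d2" "d2 \<le> 1" "\<And>l y. l \<in> {0..<d2} \<Longrightarrow> y \<in> C \<inter> ?F \<Longrightarrow>
      (y, l) \<in> {(x, l). l \<in> {0..1} \<and> \<phi> l x T' \<in> interior C}"
  proof (rule small_parameter[OF cS family_openin(2)[OF \<phi> open_interior]])
    show "(y, 0) \<in> {(x, l). l \<in> {0..1} \<and> \<phi> l x T' \<in> interior C}" if "y \<in> C \<inter> ?F" for y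
      using that T'(2) by auto
  qed blast
  show thesis
  proof (rule that[of "min d1 d2"])
    fix l assume l: "l \<in> {0..<min d1 d2}"
    then have l01: "l \<in> {0..1}" using d1(2) by auto
    note f = fl[OF l01]
    have inP: "\<phi> l x t \<in> interior P" if "x \<in> C \<inter> ?F" "0 \<le> t" "t \<le> T'" for x t
      using d1(3)[of l "(x, t)"] l that by auto
    have side: "\<phi> l x t \<in> ?F" if x: "x \<in> C \<inter> ?F" and t: "0 \<le> t" "t \<le> T'" for x t
    proof (cases "x \<in> K")
      case True
      then have "\<phi> l x t \<in> K" using K[OF l01] by (simp add: invariant_set_def)
      then show ?thesis using P(3) by (auto simp: Inv_eq_fwd_bwd)
    next
      case False
      let ?S = "\<phi> l x ` {0..t}"
      have "connected ?S"
        by (intro connected_continuous_image flow_continuous[OF f] continuous_intros) simp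
      moreover have "closed ?F" "closed ?B"
        using closed_fwd closed_bwd f0 compact_imp_closed[OF P(1)] by blast+
      moreover have "?S \<subseteq> ?F \<union> ?B"
      proof
        fix y assume "y \<in> ?S"
        then have "y \<in> interior P" using inP[OF x] t(2) by auto
        then show "y \<in> ?F \<union> ?B" using P(2) interior_subset by blast
      qed
      moreover have "?F \<inter> ?B \<inter> ?S = {}"
      proof (rule ccontr)
        assume "?F \<inter> ?B \<inter> ?S \<noteq> {}"
        then obtain s where "\<phi> l x s \<in> K" using P(3) by (auto simp: Inv_eq_fwd_bwd)
        then have "\<phi> l (\<phi> l x s) (- s) \<in> K" using K[OF l01] unfolding invariant_set_def by blast
        then show False using False by (simp add: flowD[OF f])
      qed
      ultimately have "?F \<inter> ?S = {} \<or> ?B \<inter> ?S = {}"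
        using connected_closedD[of ?S ?F ?B] by blast
      moreover have "x \<in> ?F \<inter> ?S"
        using x t(1) flowD(1)[OF f, of x] by (auto intro!: image_eqI[of _ _ 0])
      moreover have "\<phi> l x t \<in> ?S" using t(1) by auto
      ultimately show ?thesis using \<open>?S \<subseteq> ?F \<union> ?B\<close> by blast
    qed
    have step: "\<phi> l x T' \<in> C \<inter> ?F" if "x \<in> C \<inter> ?F" for x
      using d2(3)[of l x] side[OF that] l that T'(1) interior_subset by auto
    show "C \<inter> ?F \<subseteq> fwd (\<phi> l) P"
    proof
      fix x assume x: "x \<in> C \<inter> ?F"
      have n: "\<phi> l x (real n * T') \<in> C \<inter> ?F" for n
      proof (induction n)
        case 0
        then show ?case using x by (simp add: flowD(1)[OF f])
      next
        case (Suc n)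
        then show ?case using step[OF Suc] by (simp add: flowD(2)[OF f] algebra_simps)
      qed
      have "\<phi> l x t \<in> P" if "t \<ge> 0" for t
      proof -
        define n where "n = nat \<lfloor>t / T'\<rfloor>"
        have "real n \<le> t / T'" "t / T' \<le> real n + 1"
          using that T'(1) by (auto simp: n_def)
        then have s: "0 \<le> t - real n * T'" "t - real n * T' \<le> T'"
          using T'(1) by (auto simp: field_simps)
        have "\<phi> l x t = \<phi> l (\<phi> l x (real n * T')) (t - real n * T')"
          by (simp add: flowD(2)[OF f])
        also have "\<dots> \<in> P"
          using side[OF n s] fwd_subset[OF f0] by blast
        finally show ?thesis .
      qed
      then show "x \<in> fwd (\<phi> l) P" by (simp add: fwd_def)
    qed
  qed (use d1 d2 in auto)
qed

section \<open>Trapping sets and continuation\<close>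

text \<open>Non-saddleness in a form that can be perturbed: a single compact set instead of a
  condition on all neighbourhoods. \<open>non_saddle_trapping\<close> and
  \<open>non_saddle_Inv\<close> translate in the two directions.\<close>

definition trapping :: "('a::topological_space \<Rightarrow> real \<Rightarrow> 'a) \<Rightarrow> 'a set \<Rightarrow> bool" where
  "trapping f P \<longleftrightarrow> compact P \<and> P \<subseteq> fwd f P \<union> bwd f P \<and> Inv f P \<subseteq> interior P"

text \<open>Forward trapped points stay forward trapped along their forward orbits, and likewise
  backwards, so these half-orbits remain in the smaller set \<open>P\<close>. The set
  \<open>V\<close> makes \<open>P\<close> a neighbourhood of \<open>Inv f N\<close>.\<close>

lemma trapping_fwd_bwd:
  fixes f :: "'a::t2_space \<Rightarrow> real \<Rightarrow> 'a"
  assumes f: "is_flow f" and N: "compact N" and V: "Inv f N \<subseteq> interior V" "V \<subseteq> fwd f N \<union> bwd f N"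
  defines "P \<equiv> fwd f N \<union> bwd f N"
  shows "trapping f P" "P \<subseteq> N" "Inv f P = Inv f N" "V \<subseteq> P"
proof -
  show PN: "P \<subseteq> N"
    using fwd_subset[OF f] bwd_subset[OF f] by (simp add: P_def)
  show "V \<subseteq> P" using V(2) by (simp add: P_def)
  then have int: "Inv f N \<subseteq> interior P"
    using V(1) interior_mono by blast
  show inv: "Inv f P = Inv f N"
  proof
    show "Inv f P \<subseteq> Inv f N" using PN by (rule Inv_mono)
    show "Inv f N \<subseteq> Inv f P"
      using invariant_subset_Inv[OF invariant_Inv[OF f]] int interior_subset by blast
  qed
  have "f x t \<in> P" if "x \<in> fwd f N" "t \<ge> 0" for x t
    using fwd_flow[OF f that] by (simp add: P_def)
  then have "x \<in> fwd f P" if "x \<in> fwd f N" for x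
    using that by (simp add: fwd_def[of f P])
  moreover have "f x t \<in> P" if "x \<in> bwd f N" "t \<le> 0" for x t
    using bwd_flow[OF f that] by (simp add: P_def)
  then have "x \<in> bwd f P" if "x \<in> bwd f N" for x
    using that by (simp add: bwd_def[of f P])
  ultimately have "P \<subseteq> fwd f P \<union> bwd f P" by (auto simp: P_def)
  then show "trapping f P"
    using compact_fwd_bwd_Inv[OF f N] int inv by (simp add: trapping_def P_def compact_Un)
qed

lemma non_saddle_trapping:
  fixes f :: "'a::t2_space \<Rightarrow> real \<Rightarrow> 'a"
  assumes f: "is_flow f" and K: "non_saddle f K" and N: "isolating_nbhd f N K"
  obtains P where "trapping f P" "P \<subseteq> N" "Inv f P = K"
proof -
  obtain V where V: "K \<subseteq> interior V" "\<forall>x\<in>V. (\<forall>t\<ge>0. f x t \<in> N) \<or> (\<forall>t\<le>0. f x t \<in> N)"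
    using K N unfolding non_saddle_def isolating_nbhd_def by blast
  have "V \<subseteq> fwd f N \<union> bwd f N"
    using V(2) by (auto simp: fwd_def bwd_def)
  then show thesis
    using trapping_fwd_bwd[OF f, of N V] N V(1) that unfolding isolating_nbhd_def by blast
qed

lemma continuous_on_time_slice:
  assumes "continuous_on (P \<times> I) (\<lambda>(x, s). H x s)" "L \<subseteq> P" "s \<in> I"
  shows "continuous_on L (\<lambda>x. H x s)"
proof -
  have "continuous_on L (\<lambda>x. case (x, s) of (x, s) \<Rightarrow> H x s)"
    by (rule continuous_on_compose2[OF assms(1)]) (use assms(2,3) in \<open>auto intro: continuous_on_Pair\<close>)
  then show ?thesis by simp
qed

text \<open>Continuity extends the class to an open neighbourhood of the invariant set, and the
  final map of the deformation pulls it back to \<open>P\<close>. That map fixes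
  \<open>Inv f P\<close> pointwise, so the restriction is the given class.\<close>

lemma cech_extend_trapping:
  fixes f :: "'a::t2_space \<Rightarrow> real \<Rightarrow> 'a"
  assumes f: "is_flow f" and P: "trapping f P" and a: "a \<in> cech_reps (Inv f P) q"
  obtains b where "b \<in> cech_reps P q" "pb_eq (Inv f P) q (\<lambda>x. x) (\<lambda>x. x) b a"
proof -
  let ?K = "Inv f P"
  have P': "compact P" "P \<subseteq> fwd f P \<union> bwd f P" "?K \<subseteq> interior P"
    using P by (auto simp: trapping_def)
  obtain E a' where E: "open E" "?K \<subseteq> E" "a' \<in> cech_reps E q" "pb_eq ?K q (\<lambda>x. x) (\<lambda>x. x) a' a"
    using cech_extend[OF P'(1) compact_fwd_bwd_Inv(3)[OF f P'(1)] P'(3) a] .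
  obtain H where H: "continuous_on (P \<times> {0..1::real}) (\<lambda>(x, s). H x s)"
    "\<And>x. x \<in> P \<Longrightarrow> H x 1 \<in> E" "\<And>x s. x \<in> ?K \<Longrightarrow> H x s = x"
    using deformation[OF f P'(1,2) E(1,2)] by metis
  have "continuous_on P (\<lambda>x. H x 1)"
    using continuous_on_time_slice[OF H(1)] by simp
  then obtain b where b: "b \<in> cech_reps P q" "pb_eq P q (\<lambda>x. x) (\<lambda>x. H x 1) b a'"
    using pb_rep_exists[of P "\<lambda>x. H x 1" E a' q] H(2) E(3) by (metis image_subsetI)
  have "pb_eq ?K q (\<lambda>x. x) (\<lambda>x. H x 1) b a'"
    using pb_eq_subset[OF b(2) Inv_subset[OF f]] .
  then have "pb_eq ?K q (\<lambda>x. x) (\<lambda>x. x) b a'"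
    by (rule pb_eq_cong) (simp_all add: H(3))
  then show thesis
    using that[OF b(1)] pb_eq_trans[OF _ E(4) cech_repsD(2)[OF E(3)]] by blast
qed

text \<open>Given \<open>K \<subseteq> L \<subseteq> P \<subseteq> Q\<close>, classes on \<open>L\<close> that agree on \<open>K\<close> are extended to \<open>Q\<close> with the flow
  \<open>g\<close>; there they agree near \<open>K\<close>, and \<open>f\<close> deforms \<open>P\<close> inside \<open>Q\<close> into that neighbourhood.\<close>
lemma cech_iso_sandwich:
  fixes f g :: "'a::t2_space \<Rightarrow> real \<Rightarrow> 'a"
  assumes f: "is_flow f" and g: "is_flow g" and P: "trapping f P" and Q: "trapping g Q"
    and sub: "Inv f P \<subseteq> Inv g Q" "Inv g Q \<subseteq> P" "P \<subseteq> Q"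
  shows "cech_cohomology (Inv g Q) q \<cong> cech_cohomology (Inv f P) q"
proof (rule cech_restriction_iso)
  let ?K = "Inv f P" and ?L = "Inv g Q"
  have P': "compact P" "P \<subseteq> fwd f P \<union> bwd f P" "?K \<subseteq> interior P"
    and Q': "compact Q" using P Q by (auto simp: trapping_def)
  show "?K \<subseteq> ?L" by fact
  show "\<exists>a\<in>cech_reps ?L q. pb_eq ?K q (\<lambda>x. x) (\<lambda>x. x) a b" if b: "b \<in> cech_reps ?K q" for b
  proof -
    obtain c where c: "c \<in> cech_reps P q" "pb_eq ?K q (\<lambda>x. x) (\<lambda>x. x) c b"
      using cech_extend_trapping[OF f P b] .
    obtain a where a: "a \<in> cech_reps ?L q" "pb_eq ?L q (\<lambda>x. x) (\<lambda>x. x) a c"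
      using pb_rep_exists[OF continuous_on_id _ c(1), of ?L] sub(2) unfolding image_ident by blast
    show ?thesis
      using a(1) pb_eq_trans[OF pb_eq_subset[OF a(2) sub(1)] c(2) cech_repsD(2)[OF c(1)]] by blast
  qed
  fix a1 a2 assume a: "a1 \<in> cech_reps ?L q" "a2 \<in> cech_reps ?L q"
    and eq: "pb_eq ?K q (\<lambda>x. x) (\<lambda>x. x) a1 a2"
  \<comment> \<open>The extension has to reach \<open>Q\<close>: the homotopy below moves
    \<open>?L\<close> inside \<open>P\<close>, where \<open>a1\<close> and \<open>a2\<close> need
    not be defined.\<close>
  obtain c1 where c1: "c1 \<in> cech_reps Q q" "pb_eq ?L q (\<lambda>x. x) (\<lambda>x. x) c1 a1"
    using cech_extend_trapping[OF g Q a(1)] .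
  obtain c2 where c2: "c2 \<in> cech_reps Q q" "pb_eq ?L q (\<lambda>x. x) (\<lambda>x. x) c2 a2"
    using cech_extend_trapping[OF g Q a(2)] .
  note coc = cech_repsD(2)[OF a(1)] cech_repsD(2)[OF a(2)] cech_repsD(2)[OF c1(1)] cech_repsD(2)[OF c2(1)]
  have "pb_eq ?K q (\<lambda>x. x) (\<lambda>x. x) c1 c2"
    using pb_eq_trans[OF pb_eq_trans[OF pb_eq_subset[OF c1(2) sub(1)] eq coc(1)]
        pb_eq_sym[OF pb_eq_subset[OF c2(2) sub(1)]] coc(2)] .
  then obtain E where E: "open E" "?K \<subseteq> E" "pb_eq E q (\<lambda>x. x) (\<lambda>x. x) c1 c2"
    using pb_eq_nbhd[OF P'(1) compact_fwd_bwd_Inv(3)[OF f P'(1)] P'(3) c1(1) c2(1), of "interior P"]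
      P'(3) sub(3) interior_subset by (metis open_interior subset_trans)
  obtain H where H: "continuous_on (P \<times> {0..1::real}) (\<lambda>(x, s). H x s)"
    "\<And>x. x \<in> P \<Longrightarrow> H x 0 = x" "\<And>x. x \<in> P \<Longrightarrow> H x 1 \<in> E"
    "\<And>x s. x \<in> P \<Longrightarrow> s \<in> {0..1} \<Longrightarrow> H x s \<in> P"
    using deformation[OF f P'(1,2) E(1,2)] by metis
  \<comment> \<open>The final map sends \<open>?L\<close> into \<open>E\<close>, where
    \<open>c1\<close> and \<open>c2\<close> agree; its homotopy to the inclusion carries the
    agreement back to \<open>?L\<close>.\<close>
  have hom: "pb_eq ?L q (\<lambda>x. x) (\<lambda>x. H x 1) c c" if "c \<in> cech_reps Q q" for c
  proof -
    have "pb_eq ?L q (\<lambda>x. H x 0) (\<lambda>x. H x 1) c c"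
    proof (rule pb_eq_homotopy[OF compact_fwd_bwd_Inv(3)[OF g Q'] _ _ that])
      show "continuous_on (?L \<times> {0..1}) (\<lambda>(x, t). H x t)"
        using continuous_on_subset[OF H(1)] sub(2) by (meson Sigma_mono order_refl)
      show "H x t \<in> Q" if "x \<in> ?L" "t \<in> {0..1}" for x t
        using H(4)[OF _ that(2)] that(1) sub(2,3) by blast
    qed
    then show ?thesis
      by (rule pb_eq_cong) (use H(2) sub(2) in auto)
  qed
  have "continuous_on ?L (\<lambda>x. H x 1)"
    using continuous_on_time_slice[OF H(1) sub(2)] by simp
  then have "pb_eq ?L q (\<lambda>x. H x 1) (\<lambda>x. H x 1) c1 c2"
    using pb_eq_pullback[OF E(3), of ?L "\<lambda>x. H x 1"] H(3) sub(2) by blast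
  from pb_eq_trans[OF pb_eq_trans[OF hom[OF c1(1)] this coc(3)] pb_eq_sym[OF hom[OF c2(1)]] coc(4)]
  have "pb_eq ?L q (\<lambda>x. x) (\<lambda>x. x) c1 c2" .
  from pb_eq_trans[OF pb_eq_trans[OF pb_eq_sym[OF c1(2)] this coc(3)] c2(2) coc(4)]
  show "pb_eq ?L q (\<lambda>x. x) (\<lambda>x. x) a1 a2" .
qed

text \<open>\<open>C\<close> is taken so small that unperturbed half-orbits of its trapped points
  stay in the interior of \<open>P\<close>, which leaves room for a perturbation. The backward half
  is \<open>fwd_persists\<close> for the reversed family.\<close>

lemma trapping_persists:
  fixes \<phi> :: "real \<Rightarrow> 'a::t2_space \<Rightarrow> real \<Rightarrow> 'a"
  assumes \<phi>: "continuous_family_of_flows \<phi>" and K: "\<And>l. l \<in> {0..1} \<Longrightarrow> invariant_set (\<phi> l) K"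
    and P: "trapping (\<phi> 0) P" "Inv (\<phi> 0) P = K"
  obtains C d where "compact C" "K \<subseteq> interior C" "C \<subseteq> P" "0 < d" "d \<le> 1"
    "\<And>l. l \<in> {0..<d} \<Longrightarrow> C \<subseteq> fwd (\<phi> l) P \<union> bwd (\<phi> l) P"
proof -
  have f0: "is_flow (\<phi> 0)" using \<phi> by (simp add: continuous_family_of_flows_def)
  have P': "compact P" "P \<subseteq> fwd (\<phi> 0) P \<union> bwd (\<phi> 0) P" "K \<subseteq> interior P"
    using P by (auto simp: trapping_def)
  have int: "Inv (\<phi> 0) P \<subseteq> interior P" using P'(3) P(2) by simp
  have cK: "compact K" using compact_fwd_bwd_Inv(3)[OF f0 P'(1)] P(2) by simp
  obtain V1 where V1: "open V1" "Inv (\<phi> 0) P \<subseteq> V1"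
    "\<And>x t. x \<in> V1 \<inter> fwd (\<phi> 0) P \<Longrightarrow> t \<ge> 0 \<Longrightarrow> \<phi> 0 x t \<in> interior P"
    using fwd_stable[OF f0 P'(1) open_interior int] by blast
  have int': "Inv (rev_flow (\<phi> 0)) P \<subseteq> interior P" using int by (simp add: Inv_rev)
  obtain V2 where V2: "open V2" "Inv (rev_flow (\<phi> 0)) P \<subseteq> V2"
    "\<And>x t. x \<in> V2 \<inter> fwd (rev_flow (\<phi> 0)) P \<Longrightarrow> t \<ge> 0 \<Longrightarrow> rev_flow (\<phi> 0) x t \<in> interior P"
    using fwd_stable[OF is_flow_rev[OF f0] P'(1) open_interior int'] by blast
  have "K \<subseteq> V1 \<inter> V2" using V1(2) V2(2) P(2) by (simp add: Inv_rev)
  then obtain C where C: "compact C" "K \<subseteq> interior C" "C \<subseteq> V1 \<inter> V2" "C \<subseteq> P"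
    using compact_neighbourhood[OF P'(1) cK P'(3) open_Int[OF V1(1) V2(1)]] by blast
  obtain d1 where d1: "0 < d1" "d1 \<le> 1" "\<And>l. l \<in> {0..<d1} \<Longrightarrow> C \<inter> fwd (\<phi> 0) P \<subseteq> fwd (\<phi> l) P"
  proof (rule fwd_persists[OF \<phi> K P'(1,2) P(2) P'(3) C(1,2)])
    show "\<phi> 0 x t \<in> interior P" if "x \<in> C \<inter> fwd (\<phi> 0) P" "0 \<le> t" for x t
      using V1(3) C(3) that by blast
  qed blast+
  obtain d2 where d2: "0 < d2" "d2 \<le> 1" "\<And>l. l \<in> {0..<d2} \<Longrightarrow>
      C \<inter> fwd (rev_flow (\<phi> 0)) P \<subseteq> fwd (rev_flow (\<phi> l)) P"
  proof (rule fwd_persists[OF family_rev[OF \<phi>] _ P'(1) _ _ P'(3) C(1,2)])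
    show "invariant_set (rev_flow (\<phi> l)) K" if "l \<in> {0..1}" for l
      using K[OF that] by (simp add: invariant_rev)
    show "P \<subseteq> fwd (rev_flow (\<phi> 0)) P \<union> bwd (rev_flow (\<phi> 0)) P"
      using P'(2) by (auto simp: bwd_eq_fwd_rev)
    show "Inv (rev_flow (\<phi> 0)) P = K" using P(2) by (simp add: Inv_rev)
    show "rev_flow (\<phi> 0) x t \<in> interior P" if "x \<in> C \<inter> fwd (rev_flow (\<phi> 0)) P" "0 \<le> t" for x t
      using V2(3) C(3) that by blast
  qed blast
  show thesis
  proof (rule that[OF C(1,2,4), of "min d1 d2"])
    fix l assume "l \<in> {0..<min d1 d2}"
    then have "C \<inter> fwd (\<phi> 0) P \<subseteq> fwd (\<phi> l) P" "C \<inter> bwd (\<phi> 0) P \<subseteq> bwd (\<phi> l) P"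
      using d1(3) d2(3) by (simp_all add: bwd_eq_fwd_rev)
    then show "C \<subseteq> fwd (\<phi> l) P \<union> bwd (\<phi> l) P"
      using C(4) P'(2) by blast
  qed (use d1 d2 in auto)
qed

theorem theorem5p1:
  fixes \<phi> :: "real \<Rightarrow> 'a::{t2_space, second_countable_topology} \<Rightarrow> real \<Rightarrow> 'a"
    and K N :: "'a set"
  assumes manifold: "locally_euclidean TYPE('a) TYPE('b::euclidean_space)"
    and family: "continuous_family_of_flows \<phi>"
    and K_compact: "compact K"
    and K_inv: "\<forall>l\<in>{0..1}. invariant_set (\<phi> l) K"
    and K_isolated: "isolated_set (\<phi> 0) K"
    and K_nonsaddle: "non_saddle (\<phi> 0) K"
    and N_isol: "isolating_nbhd (\<phi> 0) N K"
  shows "\<exists>lam0>0. lam0 \<le> 1 \<and> (\<forall>l\<in>{0..<lam0}.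
           isolated_set (\<phi> l) (Inv (\<phi> l) N) \<and> non_saddle (\<phi> l) (Inv (\<phi> l) N) \<and>
           (\<forall>q. cech_cohomology (Inv (\<phi> l) N) q \<cong> cech_cohomology K q))"
proof -
  have f0: "is_flow (\<phi> 0)" using family by (simp add: continuous_family_of_flows_def)
  have N: "compact N" "K \<subseteq> interior N" "Inv (\<phi> 0) N = K"
    using N_isol by (auto simp: isolating_nbhd_def)
  obtain P where P: "trapping (\<phi> 0) P" "P \<subseteq> N" "Inv (\<phi> 0) P = K"
    using non_saddle_trapping[OF f0 K_nonsaddle N_isol] .
  obtain C d1 where C: "compact C" "K \<subseteq> interior C" "C \<subseteq> P" and d1: "0 < d1" "d1 \<le> 1"
    "\<And>l. l \<in> {0..<d1} \<Longrightarrow> C \<subseteq> fwd (\<phi> l) P \<union> bwd (\<phi> l) P"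
    using trapping_persists[OF family _ P(1,3)] K_inv by blast
  \<comment> \<open>\<open>P\<close> is too large for the middle of the sandwich, since
    \<open>?Q\<close> below lies inside \<open>P\<close>. With \<open>C\<close> as isolating
    neighbourhood, non-saddleness yields a second trapping set \<open>R\<close>, which lies in every
    \<open>?Q\<close>.\<close>
  have "Inv (\<phi> 0) C = K"
  proof
    show "Inv (\<phi> 0) C \<subseteq> K" using Inv_mono[OF C(3)] P(3) by blast
    show "K \<subseteq> Inv (\<phi> 0) C"
      using invariant_subset_Inv[of "\<phi> 0" K C] K_inv C(2) interior_subset by fastforce
  qed
  then obtain R where R: "trapping (\<phi> 0) R" "R \<subseteq> C" "Inv (\<phi> 0) R = K"
    using non_saddle_trapping[OF f0 K_nonsaddle, of C] C(1,2) by (auto simp: isolating_nbhd_def)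
  have KR: "K \<subseteq> interior R" using R(1,3) by (simp add: trapping_def)
  obtain d2 where d2: "0 < d2" "d2 \<le> 1" "\<And>l. l \<in> {0..<d2} \<Longrightarrow> Inv (\<phi> l) N \<subseteq> interior R"
    using Inv_upper_semicontinuous[OF family N(1) open_interior[of R]] KR N(3) by blast
  have "isolated_set (\<phi> l) (Inv (\<phi> l) N) \<and> non_saddle (\<phi> l) (Inv (\<phi> l) N) \<and>
      (\<forall>q. cech_cohomology (Inv (\<phi> l) N) q \<cong> cech_cohomology K q)" if l: "l \<in> {0..<min d1 d2}" for l
  proof -
    have l01: "l \<in> {0..1}" using l d1(2) by auto
    then have f: "is_flow (\<phi> l)" using family by (simp add: continuous_family_of_flows_def)
    let ?L = "Inv (\<phi> l) N" and ?Q = "fwd (\<phi> l) P \<union> bwd (\<phi> l) P"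
    have LR: "?L \<subseteq> interior R" using d2(3) l by simp
    have RC: "interior R \<subseteq> interior C" using R(2) by (rule interior_mono)
    have LC: "?L \<subseteq> interior C" using LR RC by blast
    have L_P: "Inv (\<phi> l) P = ?L"
    proof
      show "Inv (\<phi> l) P \<subseteq> ?L" using P(2) by (rule Inv_mono)
      show "?L \<subseteq> Inv (\<phi> l) P"
        using invariant_subset_Inv[OF invariant_Inv[OF f]] LC C(3) interior_subset by blast
    qed
    have CQ: "C \<subseteq> ?Q" using d1(3) l by simp
    have cP: "compact P" using P(1) by (simp add: trapping_def)
    \<comment> \<open>Not all of \<open>P\<close> need be trapped under \<open>\<phi> l\<close>; its
      trapped part \<open>?Q\<close> is, and it is a neighbourhood of \<open>?L\<close> because it
      contains \<open>C\<close>.\<close>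
    have Q: "trapping (\<phi> l) ?Q" "Inv (\<phi> l) ?Q = ?L"
      using trapping_fwd_bwd[OF f cP _ CQ] LC L_P by simp_all
    have KL: "K \<subseteq> ?L"
      using invariant_subset_Inv[of "\<phi> l" K N] K_inv l01 N(2) interior_subset by blast
    have "isolating_nbhd (\<phi> l) N ?L"
      using N(1) LC C(3) P(2) interior_mono[of C N] by (auto simp: isolating_nbhd_def)
    then have "isolated_set (\<phi> l) ?L"
      unfolding isolated_set_def using compact_fwd_bwd_Inv(3)[OF f N(1)] invariant_Inv[OF f] by blast
    moreover have "non_saddle (\<phi> l) ?L"
      using non_saddle_Inv[OF f, of ?Q] Q by (simp add: trapping_def)
    moreover have "cech_cohomology ?L q \<cong> cech_cohomology K q" for q
      using cech_iso_sandwich[OF f0 f R(1) Q(1), of q] Q(2) R(2,3) KL LR CQ interior_subset[of R] by simp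
    ultimately show ?thesis by blast
  qed
  then show ?thesis
    using d1(1,2) d2(1) by (intro exI[of _ "min d1 d2"]) auto
qed

end
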